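(* Let $m\ge 1$ and let $\mathfrak{S}^{(m)}$ be the set of all permutations having no ascending subsequence of length $m+1$. Let $z_1,\dots,z_m$ be indeterminates, $z_0=0$, $x_j=z_j-z_{j-1}$ and $\bar x_j=1/x_j$ for $1\le j\le m$. Then the ordinary generating function of these permutations is $$\sum_{\tau\in\mathfrak{S}^{(m)}}t^{|\tau|}=\Lambda\left(\frac{\det\left(x_j^{i-j}\right)_{1\le i,j\le m}}{1-t(\bar x_1+\cdots+\bar x_m)}\right).$$ Equivalently, their exponential generating function is $$\sum_{\tau\in\mathfrak{S}^{(m)}}\frac{t^{|\tau|}}{|\tau|!}=\Lambda\left(\det\left(x_j^{i-j}e^{t\bar x_j}\right)_{1\le i,j\le m}\right).$$
   Context: For a permutation $\tau$ of $\{1,\dots,n\}$, $|\tau|=n$; the empty permutation (length $0$) is included. An ascending subsequence of length $k$ is a $k$-tuple $(\tau(i_1),\dots,\tau(i_k))$ with $i_1<\cdots<i_k$ and $\tau(i_1)<\cdots<\tau(i_k)$. Iterated Laurent series: a Laurent series involves only finitely many negative exponents. The ring of iterated Laurent series in $z_1,\dots,z_m$ (over $\mathbb{Q}$) is, for $m=1$, the ring of Laurent series in $z_1$, and for $m>1$, the ring of Laurent series in $z_1$ whose coefficients are iterated Laurent series in $z_2,\dots,z_m$. Every rational function in $z_1,\dots,z_m$ is expanded as an iterated Laurent series (expanding first in $z_1$, then in $z_2$, and so on); e.g. $1/(z_2-z_1)=\sum_{n\ge 0}z_1^n z_2^{-n-1}$. Such a series contains only finitely many monomials $z_1^{e_1}\cdots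 z_m^{e_m}$ with all $e_j\le 0$. The linear operator $\Lambda$ on iterated Laurent series in $z_1,\dots,z_m$ is defined by: $\Lambda(z_1^{e_1}\cdots z_m^{e_m})=1$ if $e_1\le 0,\dots,e_m\le 0$ and, for every $j$, $e_j=0$ implies $e_{j+1}=\cdots=e_m=0$; and $\Lambda(z_1^{e_1}\cdots z_m^{e_m})=0$ otherwise. (So $\Lambda$ of a series is the finite sum of its coefficients on monomials of the first kind.) $\Lambda$ is applied to power series in $t$ with coefficients in $\mathbb{Q}(z_1,\dots,z_m)$ coefficientwise in $t$. *)

theory Defs
  imports
    "HOL-Library.Poly_Mapping"
    "HOL-Library.Sublist"
    "HOL-Computational_Algebra.Fraction_Field"
    "HOL-Computational_Algebra.Formal_Power_Series"
    "HOL-Combinatorics.Multiset_Permutations"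
    "Jordan_Normal_Form.Determinant"
begin

section \<open>Permutations\<close>

text \<open>
  A permutation of \<open>{1..n}\<close> is the list of its values (one-line notation), so that
  \<open>|\<tau>| = length \<tau>\<close> and the subsequences of \<open>\<tau>\<close> are its sublists.
\<close>

definition has_ascending_subseq :: "nat \<Rightarrow> nat list \<Rightarrow> bool" where
  "has_ascending_subseq k \<tau> \<longleftrightarrow> (\<exists>\<sigma>. subseq \<sigma> \<tau> \<and> length \<sigma> = k \<and> sorted_wrt (<) \<sigma>)"

definition perms_no_asc :: "nat \<Rightarrow> nat list set" where
  "perms_no_asc m =
     {\<tau>. \<tau> \<in> permutations_of_set {1..length \<tau>} \<and> \<not> has_ascending_subseq (Suc m) \<tau>}"


section \<open>Rational functions\<close>

text \<open>
  Polynomials in \<open>z\<^sub>1, z\<^sub>2, \<dots>\<close> over \<open>\<rat>\<close>, as finitely supported maps from monomials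
  to coefficients, and their field of fractions.  The rational functions in
  \<open>z\<^sub>1, \<dots>, z\<^sub>m\<close> form the subfield \<open>{Fract p q | p q. p \<in> mpolys m \<and> q \<in> mpolys m \<and> q \<noteq> 0}\<close>.
\<close>

type_synonym qpoly = "(nat \<Rightarrow>\<^sub>0 nat) \<Rightarrow>\<^sub>0 rat"
type_synonym ratfun = "qpoly fract"

definition mpolys :: "nat \<Rightarrow> qpoly set" where
  "mpolys m = {p. \<forall>k\<in>Poly_Mapping.keys p. Poly_Mapping.keys k \<subseteq> {1..m}}"

definition z_var :: "nat \<Rightarrow> ratfun" where
  "z_var j = (if j = 0 then 0
          else Fract (Poly_Mapping.single (Poly_Mapping.single j 1) 1) 1)"

definition x_diff :: "nat \<Rightarrow> ratfun" where
  "x_diff j = z_var j - z_var (j - 1)"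

lemma of_nat_fract: "of_nat n = Fract (of_nat n :: 'a::idom) 1"
  by (induction n) (simp_all add: Zero_fract_def One_fract_def)

instance fract :: ("{idom, ring_char_0}") field_char_0
proof
  show "inj (of_nat :: nat \<Rightarrow> 'a fract)"
    by (rule injI) (simp add: of_nat_fract eq_fract)
qed


section \<open>Iterated Laurent series\<close>

text \<open>
  A series in \<open>z\<^sub>1, \<dots>, z\<^sub>m\<close> is given by its coefficients: \<open>f [e\<^sub>1, \<dots>, e\<^sub>m]\<close> is the
  coefficient of \<open>z\<^sub>1^e\<^sub>1 \<cdots> z\<^sub>m^e\<^sub>m\<close>, and \<open>f\<close> vanishes on lists of any other length.
  The coefficient of \<open>z\<^sub>1^e\<close>, a series in \<open>z\<^sub>2, \<dots>, z\<^sub>m\<close>, is \<open>\<lambda>es. f (e # es)\<close>.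
  For \<open>m = 0\<close> these are the constants.
\<close>

primrec iterated_laurent :: "nat \<Rightarrow> (int list \<Rightarrow> rat) \<Rightarrow> bool" where
  "iterated_laurent 0 f \<longleftrightarrow> (\<forall>es. es \<noteq> [] \<longrightarrow> f es = 0)"
| "iterated_laurent (Suc m) f \<longleftrightarrow>
     f [] = 0 \<and> (\<exists>N. \<forall>e<N. \<forall>es. f (e # es) = 0) \<and> (\<forall>e. iterated_laurent m (\<lambda>es. f (e # es)))"

definition series_mult :: "(int list \<Rightarrow> rat) \<Rightarrow> (int list \<Rightarrow> rat) \<Rightarrow> int list \<Rightarrow> rat" where
  "series_mult f g es =
     (\<Sum>(a, b) | length a = length es \<and> length b = length es \<and> map2 (+) a b = es \<and>
                f a \<noteq> 0 \<and> g b \<noteq> 0. f a * g b)"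

definition exponents :: "nat \<Rightarrow> (nat \<Rightarrow>\<^sub>0 nat) \<Rightarrow> int list" where
  "exponents m k = map (\<lambda>j. int (Poly_Mapping.lookup k j)) [1..<Suc m]"

definition series_of_poly :: "nat \<Rightarrow> qpoly \<Rightarrow> int list \<Rightarrow> rat" where
  "series_of_poly m p es =
     (\<Sum>k\<in>Poly_Mapping.keys p. Poly_Mapping.lookup p k when exponents m k = es)"

text \<open>
  The expansion of \<open>p / q\<close> is the unique iterated Laurent series \<open>f\<close> with \<open>q f = p\<close>;
  existence, uniqueness and independence of \<open>p\<close> and \<open>q\<close> are proved below
  (\<open>expansion_ex1\<close>, \<open>expansion_eqI\<close>).
\<close>

definition is_expansion :: "nat \<Rightarrow> ratfun \<Rightarrow> (int list \<Rightarrow> rat) \<Rightarrow> bool" where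
  "is_expansion m r f \<longleftrightarrow> iterated_laurent m f \<and>
     (\<exists>p\<in>mpolys m. \<exists>q\<in>mpolys m. q \<noteq> 0 \<and> r = Fract p q \<and>
        series_mult (series_of_poly m q) f = series_of_poly m p)"

definition expansion :: "nat \<Rightarrow> ratfun \<Rightarrow> int list \<Rightarrow> rat" where
  "expansion m r = (THE f. is_expansion m r f)"


section \<open>The operator \<open>\<Lambda>\<close>\<close>

definition admissible :: "int list \<Rightarrow> bool" where
  "admissible es \<longleftrightarrow> (\<forall>j<length es. es ! j \<le> 0 \<and>
     (es ! j = 0 \<longrightarrow> (\<forall>k. j < k \<and> k < length es \<longrightarrow> es ! k = 0)))"

text \<open>The index set of this sum is finite by \<open>finite_admissible\<close> below.\<close>

definition Lam :: "nat \<Rightarrow> (int list \<Rightarrow> rat) \<Rightarrow> rat" where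
  "Lam m f = (\<Sum>es | length es = m \<and> admissible es \<and> f es \<noteq> 0. f es)"

definition Lam_fps :: "nat \<Rightarrow> ratfun fps \<Rightarrow> rat fps" where
  "Lam_fps m F = Abs_fps (\<lambda>n. Lam m (expansion m (fps_nth F n)))"


section \<open>Finiteness of the sum defining \<open>\<Lambda>\<close>\<close>

lemma iterated_laurent_SucI:
  "f [] = 0 \<Longrightarrow> (\<And>e es. e < N \<Longrightarrow> f (e # es) = 0) \<Longrightarrow>
   (\<And>e. iterated_laurent m (\<lambda>es. f (e # es))) \<Longrightarrow> iterated_laurent (Suc m) f"
  by auto

lemma iterated_laurent_SucD:
  assumes "iterated_laurent (Suc m) f"
  shows "f [] = 0" "iterated_laurent m (\<lambda>es. f (e # es))"
  using assms by auto

lemma iterated_laurent_bound: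
  assumes "iterated_laurent (Suc m) f"
  obtains N where "\<And>e es. e < N \<Longrightarrow> f (e # es) = 0"
proof -
  from assms have "\<exists>N. \<forall>e<N. \<forall>es. f (e # es) = 0" by simp
  with that show thesis by blast
qed

lemma iterated_laurent_length:
  "iterated_laurent m f \<Longrightarrow> f es \<noteq> 0 \<Longrightarrow> length es = m"
proof (induction m arbitrary: f es)
  case (Suc m)
  then obtain e es' where es: "es = e # es'" by (cases es) auto
  with Suc.prems have "iterated_laurent m (\<lambda>es. f (e # es))" "f (e # es') \<noteq> 0" by auto
  from Suc.IH[OF this] es show ?case by simp
qed auto

lemma finite_nonpos:
  "iterated_laurent m f \<Longrightarrow> finite {es. (\<forall>e\<in>set es. e \<le> 0) \<and> f es \<noteq> 0}"
proof (induction m arbitrary: f)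
  case 0
  then have "{es. (\<forall>e\<in>set es. e \<le> 0) \<and> f es \<noteq> 0} \<subseteq> {[]}" by auto
  then show ?case by (rule finite_subset) simp
next
  case (Suc m)
  then obtain N where N: "\<And>e es. e < N \<Longrightarrow> f (e # es) = 0" using iterated_laurent_bound by blast
  let ?S = "\<lambda>e. {es. (\<forall>e\<in>set es. e \<le> 0) \<and> f (e # es) \<noteq> 0}"
  have "{es. (\<forall>e\<in>set es. e \<le> 0) \<and> f es \<noteq> 0} \<subseteq> (\<Union>e\<in>{N..0}. (#) e ` ?S e)"
  proof
    fix es assume es: "es \<in> {es. (\<forall>e\<in>set es. e \<le> 0) \<and> f es \<noteq> 0}"
    then obtain e es' where "es = e # es'" using Suc.prems by (cases es) auto
    with es N[of e es'] show "es \<in> (\<Union>e\<in>{N..0}. (#) e ` ?S e)" by (force simp: not_less[symmetric])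
  qed
  moreover have "finite (\<Union>e\<in>{N..0}. (#) e ` ?S e)"
    using Suc.IH Suc.prems by auto
  ultimately show ?case by (rule finite_subset)
qed

lemma finite_admissible:
  assumes "iterated_laurent m f"
  shows "finite {es. length es = m \<and> admissible es \<and> f es \<noteq> 0}"
  by (rule finite_subset[OF _ finite_nonpos[OF assms]])
     (auto simp: admissible_def in_set_conv_nth)


section \<open>Existence and uniqueness of the expansion\<close>

lemma iterated_laurent_add:
  "iterated_laurent m f \<Longrightarrow> iterated_laurent m g \<Longrightarrow> iterated_laurent m (\<lambda>es. f es + g es)"
proof (induction m arbitrary: f g)
  case (Suc m)
  obtain M where M: "\<And>e es. e < M \<Longrightarrow> f (e # es) = 0"
    using Suc.prems(1) by (rule iterated_laurent_bound) blast
  obtain N where N: "\<And>e es. e < N \<Longrightarrow> g (e # es) = 0"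
    using Suc.prems(2) by (rule iterated_laurent_bound) blast
  show ?case
    by (rule iterated_laurent_SucI[where N = "min M N"])
       (use Suc M N in \<open>simp_all del: iterated_laurent.simps add: iterated_laurent_SucD\<close>)
qed auto

lemma iterated_laurent_smult:
  "iterated_laurent m f \<Longrightarrow> iterated_laurent m (\<lambda>es. c * f es)"
proof (induction m arbitrary: f)
  case (Suc m)
  then obtain M where "\<forall>e<M. \<forall>es. f (e # es) = 0" by auto
  then have "\<forall>e<M. \<forall>es. c * f (e # es) = 0" by auto
  with Suc show ?case by auto
qed auto

lemma iterated_laurent_diff:
  "iterated_laurent m f \<Longrightarrow> iterated_laurent m g \<Longrightarrow> iterated_laurent m (\<lambda>es. f es - g es)"
  using iterated_laurent_add[of m f "\<lambda>es. (-1) * g es"] iterated_laurent_smult[of m g "-1"] by simp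

lemma iterated_laurent_zero: "iterated_laurent m (\<lambda>es. 0)"
  by (induction m) auto

lemma iterated_laurent_sum:
  "(\<And>i. i \<in> I \<Longrightarrow> iterated_laurent m (f i)) \<Longrightarrow> iterated_laurent m (\<lambda>es. \<Sum>i\<in>I. f i es)"
  by (induction I rule: infinite_finite_induct)
     (auto intro: iterated_laurent_add iterated_laurent_zero)

lemma iterated_laurent_shift:
  "iterated_laurent m f \<Longrightarrow> length a = m \<Longrightarrow>
   iterated_laurent m (\<lambda>es. if length es = m then f (map2 (-) es a) else 0)"
proof (induction m arbitrary: f a)
  case (Suc m)
  from Suc.prems(2) obtain d b where a: "a = d # b" "length b = m" by (cases a) auto
  obtain M where M: "\<And>e es. e < M \<Longrightarrow> f (e # es) = 0"
    using Suc.prems(1) by (rule iterated_laurent_bound) blast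
  have "iterated_laurent m (\<lambda>es. if length es = m then f ((e - d) # map2 (-) es b) else 0)" for e
    using Suc.IH[of "\<lambda>es. f ((e - d) # es)" b] Suc.prems(1) a by auto
  then show ?case
    unfolding a(1) by (intro iterated_laurent_SucI[where N = "M + d"]) (simp_all add: M cong: if_cong)
qed auto

definition laurent_poly :: "nat \<Rightarrow> (int list \<Rightarrow> rat) \<Rightarrow> bool" where
  "laurent_poly m q \<longleftrightarrow> finite {a. q a \<noteq> 0} \<and> (\<forall>a. q a \<noteq> 0 \<longrightarrow> length a = m)"

definition poly_act :: "(int list \<Rightarrow> rat) \<Rightarrow> (int list \<Rightarrow> rat) \<Rightarrow> int list \<Rightarrow> rat" where
  "poly_act q f es = (\<Sum>a | q a \<noteq> 0. q a * f (map2 (-) es a))"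

lemma map2_minus_eq_iff:
  "length a = length es \<Longrightarrow> length b = length es \<Longrightarrow>
   map2 (+) a b = es \<longleftrightarrow> b = map2 (-) es (a :: int list)"
proof (induction es arbitrary: a b)
  case (Cons e es)
  then obtain a0 a' b0 b' where ab: "a = a0 # a'" "b = b0 # b'"
    by (cases a; cases b) auto
  with Cons have "map2 (+) a' b' = es \<longleftrightarrow> b' = map2 (-) es a'" by simp
  with ab show ?case by auto
qed auto

lemma series_mult_laurent_poly:
  assumes "laurent_poly m q"
  shows "series_mult q f es = (if length es = m then poly_act q f es else 0)"
proof (cases "length es = m")
  case True
  have q: "finite {a. q a \<noteq> 0}" "\<And>a. q a \<noteq> 0 \<Longrightarrow> length a = length es"
    using assms True by (auto simp: laurent_poly_def)
  let ?A = "{a. q a \<noteq> 0 \<and> f (map2 (-) es a) \<noteq> 0}"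
  have iff: "length a = length es \<and> length b = length es \<and> map2 (+) a b = es \<and> q a \<noteq> 0 \<and> f b \<noteq> 0
      \<longleftrightarrow> a \<in> ?A \<and> b = map2 (-) es a" for a b
  proof (cases "length a = length es")
    case True
    then have "length b = length es \<and> map2 (+) a b = es \<longleftrightarrow> b = map2 (-) es a"
      using map2_minus_eq_iff[OF True, of b] True by (cases "length b = length es") auto
    then have "length a = length es \<and> length b = length es \<and> map2 (+) a b = es \<and> q a \<noteq> 0 \<and> f b \<noteq> 0
        \<longleftrightarrow> b = map2 (-) es a \<and> q a \<noteq> 0 \<and> f b \<noteq> 0"
      using True by argo
    then show ?thesis by (simp only: mem_Collect_eq) (simp add: conj_ac cong: conj_cong)
  qed (use q(2) in blast)
  have "{(a, b). length a = length es \<and> length b = length es \<and> map2 (+) a b = es \<and> q a \<noteq> 0 \<and> f b \<noteq> 0}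
        = (\<lambda>a. (a, map2 (-) es a)) ` ?A"
    unfolding iff by blast
  then have "series_mult q f es = (\<Sum>a\<in>?A. q a * f (map2 (-) es a))"
    by (simp add: series_mult_def sum.reindex inj_on_def)
  also have "\<dots> = poly_act q f es"
    unfolding poly_act_def by (rule sum.mono_neutral_left) (use q in auto)
  finally show ?thesis using True by simp
next
  case False
  have "length a \<noteq> length es" if "q a \<noteq> 0" for a
  proof -
    have "length a = m" using assms that by (simp add: laurent_poly_def)
    with False show ?thesis by simp
  qed
  then have empty: "{(a, b). length a = length es \<and> length b = length es \<and> map2 (+) a b = es \<and>
      q a \<noteq> 0 \<and> f b \<noteq> 0} = {}"
    by blast
  show ?thesis using False unfolding series_mult_def empty by simp
qed

lemma iterated_laurent_act:
  assumes "laurent_poly m q" "iterated_laurent m f"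
  shows "iterated_laurent m (\<lambda>es. if length es = m then poly_act q f es else 0)"
proof -
  have "iterated_laurent m
     (\<lambda>es. \<Sum>a | q a \<noteq> 0. q a * (if length es = m then f (map2 (-) es a) else 0))"
    using assms by (intro iterated_laurent_sum iterated_laurent_smult iterated_laurent_shift)
                   (auto simp: laurent_poly_def)
  also have "(\<lambda>es. \<Sum>a | q a \<noteq> 0. q a * (if length es = m then f (map2 (-) es a) else 0)) =
      (\<lambda>es. if length es = m then poly_act q f es else 0)"
    by (auto simp: poly_act_def fun_eq_iff)
  finally show ?thesis .
qed

lemma laurent_poly_Cons: "laurent_poly (Suc m) q \<Longrightarrow> laurent_poly m (\<lambda>a. q (i # a))"
  unfolding laurent_poly_def
  using finite_vimageI[of "{a. q a \<noteq> 0}" "(#) i"] by (auto simp: vimage_def)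

definition heads :: "(int list \<Rightarrow> rat) \<Rightarrow> int set" where
  "heads q = hd ` {a. q a \<noteq> 0}"

lemma finite_heads: "laurent_poly m q \<Longrightarrow> finite (heads q)"
  by (auto simp: heads_def laurent_poly_def)

lemma not_heads: "i \<notin> heads q \<Longrightarrow> q (i # a) = 0"
  by (force simp: heads_def)

lemma poly_act_Cons:
  assumes q: "laurent_poly (Suc m) q"
  shows "poly_act q f (e # es) =
    (\<Sum>i\<in>heads q. poly_act (\<lambda>a. q (i # a)) (\<lambda>b. f ((e - i) # b)) es)"
proof -
  have fin: "finite {a. q (i # a) \<noteq> 0}" for i
    using laurent_poly_Cons[OF q] by (simp add: laurent_poly_def)
  have "{a. q a \<noteq> 0} = (\<lambda>(i, a). i # a) ` (SIGMA i:heads q. {a. q (i # a) \<noteq> 0})"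
  proof (intro equalityI subsetI)
    fix a assume a: "a \<in> {a. q a \<noteq> 0}"
    with q obtain i b where "a = i # b" by (cases a) (auto simp: laurent_poly_def)
    with a show "a \<in> (\<lambda>(i, a). i # a) ` (SIGMA i:heads q. {a. q (i # a) \<noteq> 0})"
      by (auto simp: heads_def image_iff intro!: bexI[of _ "i # b"])
  qed auto
  then have "poly_act q f (e # es) =
      (\<Sum>(i, a)\<in>(SIGMA i:heads q. {a. q (i # a) \<noteq> 0}). q (i # a) * f ((e - i) # map2 (-) es a))"
    by (simp add: poly_act_def sum.reindex inj_on_def case_prod_unfold)
  also have "\<dots> = (\<Sum>i\<in>heads q. poly_act (\<lambda>a. q (i # a)) (\<lambda>b. f ((e - i) # b)) es)"
    unfolding poly_act_def
    by (subst sum.Sigma) (auto simp: finite_heads[OF q] fin)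
  finally show ?thesis .
qed

lemma poly_act_zero: "(\<And>es. f es = 0) \<Longrightarrow> poly_act q f es = 0"
  by (simp add: poly_act_def)

lemma poly_act_diff: "poly_act q (\<lambda>es. f es - g es) es = poly_act q f es - poly_act q g es"
  by (simp add: poly_act_def algebra_simps sum_subtractf)

lemma poly_act_cong:
  assumes "laurent_poly m q" "length es = m" "\<And>a. length a = m \<Longrightarrow> f a = g a"
  shows "poly_act q f es = poly_act q g es"
  using assms by (auto simp: poly_act_def laurent_poly_def intro!: sum.cong)

lemma map2_minus_commute:
  "map2 (-) (map2 (-) es a) b = map2 (-) (map2 (-) es b) (a :: int list)"
proof (induction es arbitrary: a b)
  case (Cons e es)
  then show ?case by (cases a; cases b) auto
qed auto

lemma poly_act_commute: "poly_act p (poly_act q f) es = poly_act q (poly_act p f) es"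
  unfolding poly_act_def sum_distrib_left
  by (subst sum.swap) (simp add: map2_minus_commute mult.left_commute)

lemma least_head:
  assumes q: "laurent_poly (Suc m) q" "q a \<noteq> 0"
  obtains N a' where "N \<in> heads q" "\<And>i. i \<in> heads q \<Longrightarrow> N \<le> i" "q (N # a') \<noteq> 0"
proof -
  have "heads q \<noteq> {}" "finite (heads q)" using q finite_heads by (auto simp: heads_def)
  then have N: "Min (heads q) \<in> heads q" "\<And>i. i \<in> heads q \<Longrightarrow> Min (heads q) \<le> i" by auto
  then obtain b where "q b \<noteq> 0" "hd b = Min (heads q)" by (auto simp: heads_def)
  moreover from this q obtain i b' where "b = i # b'" by (cases b) (auto simp: laurent_poly_def)
  ultimately show ?thesis using N that by auto
qed

lemma poly_act_eq_0D:
  "laurent_poly m q \<Longrightarrow> q a \<noteq> 0 \<Longrightarrow> iterated_laurent m f \<Longrightarrow>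
   (\<And>es. length es = m \<Longrightarrow> poly_act q f es = 0) \<Longrightarrow> f es = 0"
proof (induction m arbitrary: q a f es)
  case 0
  then have *: "b = []" if "q b \<noteq> 0" for b using that by (auto simp: laurent_poly_def)
  with 0 have "q [] \<noteq> 0" by metis
  with * have "{a. q a \<noteq> 0} = {[]}" by auto
  then show ?case using 0(4)[of "[]"] 0(3) \<open>q [] \<noteq> 0\<close> by (cases "es = []") (auto simp: poly_act_def)
next
  case (Suc m)
  obtain N a' where N: "N \<in> heads q" "\<And>i. i \<in> heads q \<Longrightarrow> N \<le> i" "q (N # a') \<noteq> 0"
    using least_head[OF Suc.prems(1,2)] by metis
  obtain M where M: "\<And>e es. e < M \<Longrightarrow> f (e # es) = 0"
    using Suc.prems(3) by (rule iterated_laurent_bound) blast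
  have *: "\<forall>es. f ((M + int k) # es) = 0" for k
  proof (induction k rule: less_induct)
    case (less k)
    have low: "f (e # es) = 0" if "e < M + int k" for e es
    proof (cases "e < M")
      case False
      then have "nat (e - M) < k" "M + int (nat (e - M)) = e" using that by auto
      then show ?thesis using less.IH[of "nat (e - M)"] by simp
    qed (use M in auto)
    have "poly_act (\<lambda>a. q (N # a)) (\<lambda>b. f ((M + int k) # b)) es = 0" if "length es = m" for es
    proof -
      let ?g = "\<lambda>i. poly_act (\<lambda>a. q (i # a)) (\<lambda>b. f ((M + int k + N - i) # b)) es"
      have "0 = (\<Sum>i\<in>heads q. ?g i)"
        using Suc.prems(4)[of "(M + int k + N) # es"] that
        by (simp add: poly_act_Cons[OF Suc.prems(1)])
      also have "\<dots> = ?g N + (\<Sum>i\<in>heads q - {N}. ?g i)"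
        using N(1) finite_heads[OF Suc.prems(1)] by (simp add: sum.remove)
      also have "(\<Sum>i\<in>heads q - {N}. ?g i) = 0"
        by (intro sum.neutral ballI poly_act_zero low) (use N(2) in force)
      finally show ?thesis by simp
    qed
    then show ?case
      using Suc.IH[OF laurent_poly_Cons[OF Suc.prems(1)] N(3) iterated_laurent_SucD(2)[OF Suc.prems(3)]]
      by blast
  qed
  show ?case
  proof (cases es)
    case (Cons e es')
    show ?thesis
    proof (cases "e < M")
      case False
      then show ?thesis using *[of "nat (e - M)"] Cons by simp
    qed (use M Cons in auto)
  qed (use Suc.prems(3) in auto)
qed

lemma poly_act_solvable:
  "laurent_poly m q \<Longrightarrow> q a \<noteq> 0 \<Longrightarrow> iterated_laurent m h \<Longrightarrow>
   \<exists>f. iterated_laurent m f \<and> (\<forall>es. length es = m \<longrightarrow> poly_act q f es = h es)"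
proof (induction m arbitrary: q a h)
  case 0
  then have *: "b = []" if "q b \<noteq> 0" for b using that by (auto simp: laurent_poly_def)
  with 0 have "q [] \<noteq> 0" by metis
  with * have "{a. q a \<noteq> 0} = {[]}" by auto
  then show ?case using \<open>q [] \<noteq> 0\<close>
    by (intro exI[of _ "\<lambda>es. if es = [] then h [] / q [] else 0"]) (auto simp: poly_act_def)
next
  case (Suc m)
  note q = Suc.prems(1)
  obtain N a' where N: "N \<in> heads q" "\<And>i. i \<in> heads q \<Longrightarrow> N \<le> i" "q (N # a') \<noteq> 0"
    using least_head[OF q Suc.prems(2)] by metis
  obtain B where B: "\<And>e es. e < B \<Longrightarrow> h (e # es) = 0"
    using Suc.prems(3) by (rule iterated_laurent_bound) blast
  define rest where "rest = (\<lambda>F k es. \<Sum>i\<in>heads q - {N}. if nat (i - N) \<le> k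
      then (if length es = m then poly_act (\<lambda>a. q (i # a)) (F (k - nat (i - N))) es else 0) else 0)"
  have "\<exists>F. \<forall>k. iterated_laurent m (F k) \<and> (\<forall>es. length es = m \<longrightarrow>
      poly_act (\<lambda>a. q (N # a)) (F k) es = h ((B + int k) # es) - rest F k es)"
  proof (rule dependent_wellorder_choice)
    fix r and F G :: "nat \<Rightarrow> int list \<Rightarrow> rat" and k
    assume FG: "\<And>y. y < k \<Longrightarrow> F y = G y"
    have "F (k - nat (i - N)) = G (k - nat (i - N))" if "i \<in> heads q - {N}" "nat (i - N) \<le> k" for i
      using that N(2)[of i] by (intro FG) auto
    then have "rest F k = rest G k"
      unfolding rest_def by (intro ext sum.cong) auto
    then show "(iterated_laurent m r \<and> (\<forall>es. length es = m \<longrightarrow>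
        poly_act (\<lambda>a. q (N # a)) r es = h ((B + int k) # es) - rest F k es)) =
      (iterated_laurent m r \<and> (\<forall>es. length es = m \<longrightarrow>
        poly_act (\<lambda>a. q (N # a)) r es = h ((B + int k) # es) - rest G k es))" by simp
  next
    fix k and F :: "nat \<Rightarrow> int list \<Rightarrow> rat"
    assume F: "\<And>y. y < k \<Longrightarrow> iterated_laurent m (F y) \<and> (\<forall>es. length es = m \<longrightarrow>
      poly_act (\<lambda>a. q (N # a)) (F y) es = h ((B + int y) # es) - rest F y es)"
    have "iterated_laurent m (rest F k)"
      unfolding rest_def
    proof (rule iterated_laurent_sum)
      fix i assume i: "i \<in> heads q - {N}"
      show "iterated_laurent m (\<lambda>es. if nat (i - N) \<le> k
        then (if length es = m then poly_act (\<lambda>a. q (i # a)) (F (k - nat (i - N))) es else 0) else 0)"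
      proof (cases "nat (i - N) \<le> k")
        case True
        then have "k - nat (i - N) < k" using N(2)[of i] i by auto
        then show ?thesis
          using iterated_laurent_act[OF laurent_poly_Cons[OF q], of "F (k - nat (i - N))" i] F True
          by simp
      qed (simp add: iterated_laurent_zero)
    qed
    moreover have "iterated_laurent m (\<lambda>es. h ((B + int k) # es))" using Suc.prems(3) by simp
    ultimately have "iterated_laurent m (\<lambda>es. h ((B + int k) # es) - rest F k es)"
      by (rule iterated_laurent_diff[rotated])
    then show "\<exists>r. iterated_laurent m r \<and> (\<forall>es. length es = m \<longrightarrow>
        poly_act (\<lambda>a. q (N # a)) r es = h ((B + int k) # es) - rest F k es)"
      by (rule Suc.IH[OF laurent_poly_Cons[OF q] N(3)])
  qed
  then obtain F where F: "\<And>k. iterated_laurent m (F k)"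
    "\<And>k es. length es = m \<Longrightarrow>
       poly_act (\<lambda>a. q (N # a)) (F k) es = h ((B + int k) # es) - rest F k es" by blast
  define f where "f = (\<lambda>es. case es of [] \<Rightarrow> 0 |
     e # b \<Rightarrow> if e < B - N then 0 else F (nat (e - (B - N))) b)"
  have f_Cons: "(\<lambda>b. f (e # b)) = (if e < B - N then (\<lambda>_. 0) else F (nat (e - (B - N))))" for e
    by (auto simp: f_def)
  have f_il: "iterated_laurent (Suc m) f"
  proof -
    have "iterated_laurent m (\<lambda>b. f (e # b))" for e
      unfolding f_Cons using F(1) iterated_laurent_zero by auto
    moreover have "\<forall>e<B - N. \<forall>es. f (e # es) = 0" by (simp add: f_def)
    moreover have "f [] = 0" by (simp add: f_def)
    ultimately show ?thesis by auto
  qed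
  have "poly_act q f es = h es" if es: "length es = Suc m" for es
  proof -
    from es obtain e b where eb: "es = e # b" "length b = m" by (cases es) auto
    let ?g = "\<lambda>i. poly_act (\<lambda>a. q (i # a)) (\<lambda>b. f ((e - i) # b)) b"
    have "poly_act q f es = (\<Sum>i\<in>heads q. ?g i)" unfolding eb by (rule poly_act_Cons[OF q])
    also have "\<dots> = ?g N + (\<Sum>i\<in>heads q - {N}. ?g i)"
      using N(1) finite_heads[OF q] by (simp add: sum.remove)
    also have "\<dots> = h es"
    proof (cases "e < B")
      case True
      have "?g i = 0" if "i \<in> heads q" for i
        by (rule poly_act_zero) (use N(2)[OF that] True in \<open>auto simp: f_def\<close>)
      then have "?g N = 0" "(\<Sum>i\<in>heads q - {N}. ?g i) = 0" using N(1) by (auto intro: sum.neutral)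
      then show ?thesis using B[OF True] eb by simp
    next
      case False
      define k where "k = nat (e - B)"
      have e: "e = B + int k" using False by (simp add: k_def)
      have "?g N = h es - rest F k b"
        using F(2)[OF eb(2), of k] unfolding f_Cons by (simp add: e eb(1))
      moreover have "(\<Sum>i\<in>heads q - {N}. ?g i) = rest F k b"
        unfolding rest_def
      proof (rule sum.cong)
        fix i assume i: "i \<in> heads q - {N}"
        with N(2) have "N < i" by force
        show "?g i = (if nat (i - N) \<le> k
            then (if length b = m then poly_act (\<lambda>a. q (i # a)) (F (k - nat (i - N))) b else 0) else 0)"
        proof (cases "nat (i - N) \<le> k")
          case True
          then have "\<not> e - i < B - N" "nat (e - i - (B - N)) = k - nat (i - N)"
            using \<open>N < i\<close> by (auto simp: e)
          then show ?thesis using True eb(2) unfolding f_Cons by simp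
        next
          case False
          then have "e - i < B - N" using \<open>N < i\<close> by (auto simp: e)
          then show ?thesis using False unfolding f_Cons by (simp add: poly_act_zero)
        qed
      qed simp
      ultimately show ?thesis by simp
    qed
    finally show ?thesis .
  qed
  with f_il show ?case by blast
qed

lemma series_of_poly_superset:
  "finite A \<Longrightarrow> Poly_Mapping.keys p \<subseteq> A \<Longrightarrow>
   series_of_poly m p es = (\<Sum>k\<in>A. Poly_Mapping.lookup p k when exponents m k = es)"
  unfolding series_of_poly_def by (rule sum.mono_neutral_left) (auto simp: in_keys_iff)

lemma series_of_poly_add: "series_of_poly m (p + q) es = series_of_poly m p es + series_of_poly m q es"
proof -
  let ?A = "Poly_Mapping.keys p \<union> Poly_Mapping.keys q"
  have "finite ?A" "Poly_Mapping.keys (p + q) \<subseteq> ?A" by (auto simp: Poly_Mapping.keys_add)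
  then show ?thesis
    by (simp add: series_of_poly_superset[of ?A] lookup_add when_add_distrib sum.distrib)
qed

lemma series_of_poly_zero: "series_of_poly m 0 es = 0"
  by (simp add: series_of_poly_def)

lemma series_of_poly_sum:
  "series_of_poly m (sum p I) es = (\<Sum>i\<in>I. series_of_poly m (p i) es)"
  by (induction I rule: infinite_finite_induct) (simp_all add: series_of_poly_add series_of_poly_zero)

lemma series_of_poly_single:
  "series_of_poly m (Poly_Mapping.single k c) es = (c when exponents m k = es)"
  by (subst series_of_poly_superset[of "{k}"]) auto

lemma qpoly_eq_sum_single:
  "p = (\<Sum>k\<in>Poly_Mapping.keys p. Poly_Mapping.single k (Poly_Mapping.lookup p k))"
  by (rule poly_mapping_eqI) (auto simp: lookup_sum lookup_single when_def in_keys_iff)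

lemma length_exponents: "length (exponents m k) = m"
  by (simp add: exponents_def)

lemma exponents_add: "exponents m (k + l) = map2 (+) (exponents m k) (exponents m l)"
  unfolding exponents_def by (simp add: lookup_add map2_map_map)

lemma keys_series_of_poly:
  assumes "series_of_poly m p es \<noteq> 0"
  shows "es \<in> exponents m ` Poly_Mapping.keys p"
proof (rule ccontr)
  assume "es \<notin> exponents m ` Poly_Mapping.keys p"
  then have "series_of_poly m p es = 0"
    unfolding series_of_poly_def by (intro sum.neutral) (auto simp: when_def)
  with assms show False by simp
qed

lemma laurent_poly_series_of_poly: "laurent_poly m (series_of_poly m p)"
proof -
  note * = keys_series_of_poly[of m p]
  from * have "{es. series_of_poly m p es \<noteq> 0} \<subseteq> exponents m ` Poly_Mapping.keys p" by blast
  then have "finite {es. series_of_poly m p es \<noteq> 0}" by (rule finite_subset) simp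
  moreover have "length es = m" if "series_of_poly m p es \<noteq> 0" for es
    using *[OF that] by (auto simp: length_exponents)
  ultimately show ?thesis by (auto simp: laurent_poly_def)
qed

lemma iterated_laurent_laurent_poly: "laurent_poly m q \<Longrightarrow> iterated_laurent m q"
proof (induction m arbitrary: q)
  case (Suc m)
  define N where "N = Min (insert 0 (heads q))"
  have "\<forall>e<N. \<forall>es. q (e # es) = 0"
  proof (intro allI impI)
    fix e es assume "e < N"
    then have "e \<notin> heads q" using finite_heads[OF Suc.prems] by (auto simp: N_def)
    then show "q (e # es) = 0" by (rule not_heads)
  qed
  moreover have "q [] = 0" using Suc.prems by (auto simp: laurent_poly_def)
  ultimately show ?case using Suc.IH[OF laurent_poly_Cons[OF Suc.prems]] by auto
qed (auto simp: laurent_poly_def)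

lemma exponents_inj:
  assumes "Poly_Mapping.keys k \<subseteq> {1..m}" "Poly_Mapping.keys l \<subseteq> {1..m}"
    and eq: "exponents m k = exponents m l"
  shows "k = l"
proof (rule poly_mapping_eqI)
  fix j
  show "Poly_Mapping.lookup k j = Poly_Mapping.lookup l j"
  proof (cases "j \<in> {1..m}")
    case True
    then have "j \<in> set [1..<Suc m]" by auto
    with eq have "int (Poly_Mapping.lookup k j) = int (Poly_Mapping.lookup l j)"
      unfolding exponents_def map_eq_conv by blast
    then show ?thesis by simp
  next
    case False
    with assms(1,2) have "j \<notin> Poly_Mapping.keys k" "j \<notin> Poly_Mapping.keys l" by blast+
    then show ?thesis by (simp add: in_keys_iff)
  qed
qed

lemma series_of_poly_exponents:
  assumes "p \<in> mpolys m" "k \<in> Poly_Mapping.keys p"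
  shows "series_of_poly m p (exponents m k) = Poly_Mapping.lookup p k"
proof -
  have inj: "exponents m l = exponents m k \<longleftrightarrow> l = k" if "l \<in> Poly_Mapping.keys p" for l
    using exponents_inj[of l m k] assms that by (auto simp: mpolys_def)
  have "series_of_poly m p (exponents m k) =
      (\<Sum>l\<in>Poly_Mapping.keys p. if l = k then Poly_Mapping.lookup p l else 0)"
    unfolding series_of_poly_def
    by (rule sum.cong) (simp_all add: when_def inj)
  also have "\<dots> = Poly_Mapping.lookup p k" using assms(2) by simp
  finally show ?thesis .
qed

lemma series_of_poly_nonzero:
  assumes "p \<in> mpolys m" "p \<noteq> 0"
  obtains a where "series_of_poly m p a \<noteq> 0"
proof -
  from assms(2) obtain k where "k \<in> Poly_Mapping.keys p" by (metis keys_eq_empty equals0I)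
  with assms(1) that series_of_poly_exponents show ?thesis by (metis in_keys_iff)
qed

lemma series_of_poly_mult:
  assumes "length es = m"
  shows "series_of_poly m (p * q) es = poly_act (series_of_poly m p) (series_of_poly m q) es"
proof -
  have single: "series_of_poly m (Poly_Mapping.single k c * q) es =
      c * series_of_poly m q (map2 (-) es (exponents m k))" for k c
  proof -
    have "Poly_Mapping.single k c * q =
        (\<Sum>l\<in>Poly_Mapping.keys q. Poly_Mapping.single (k + l) (c * Poly_Mapping.lookup q l))"
      by (subst (1) qpoly_eq_sum_single[of q]) (simp add: sum_distrib_left mult_single)
    then have "series_of_poly m (Poly_Mapping.single k c * q) es =
        (\<Sum>l\<in>Poly_Mapping.keys q. (c * Poly_Mapping.lookup q l when exponents m (k + l) = es))"
      by (simp only: series_of_poly_sum series_of_poly_single)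
    also have "\<dots> = (\<Sum>l\<in>Poly_Mapping.keys q.
        (c * Poly_Mapping.lookup q l when exponents m l = map2 (-) es (exponents m k)))"
      using assms by (simp add: exponents_add map2_minus_eq_iff length_exponents)
    also have "\<dots> = c * series_of_poly m q (map2 (-) es (exponents m k))"
      by (simp add: series_of_poly_def sum_distrib_left mult_when)
    finally show ?thesis .
  qed
  have "p * q = (\<Sum>k\<in>Poly_Mapping.keys p. Poly_Mapping.single k (Poly_Mapping.lookup p k) * q)"
    by (subst (1) qpoly_eq_sum_single[of p]) (simp add: sum_distrib_right)
  then have "series_of_poly m (p * q) es = (\<Sum>k\<in>Poly_Mapping.keys p.
      Poly_Mapping.lookup p k * series_of_poly m q (map2 (-) es (exponents m k)))"
    by (simp add: series_of_poly_sum single)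
  also have "\<dots> = (\<Sum>a\<in>exponents m ` Poly_Mapping.keys p. \<Sum>k | k \<in> Poly_Mapping.keys p \<and> exponents m k = a.
      Poly_Mapping.lookup p k * series_of_poly m q (map2 (-) es (exponents m k)))"
    by (rule sum.image_gen) simp
  also have "\<dots> = (\<Sum>a\<in>exponents m ` Poly_Mapping.keys p. series_of_poly m p a * series_of_poly m q (map2 (-) es a))"
  proof (rule sum.cong)
    fix a
    have "series_of_poly m p a = (\<Sum>k | k \<in> Poly_Mapping.keys p \<and> exponents m k = a. Poly_Mapping.lookup p k)"
      unfolding series_of_poly_def when_def by (simp add: sum.inter_filter)
    then show "(\<Sum>k | k \<in> Poly_Mapping.keys p \<and> exponents m k = a.
        Poly_Mapping.lookup p k * series_of_poly m q (map2 (-) es (exponents m k))) =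
      series_of_poly m p a * series_of_poly m q (map2 (-) es a)"
      by (simp add: sum_distrib_right)
  qed simp
  also have "\<dots> = poly_act (series_of_poly m p) (series_of_poly m q) es"
    unfolding poly_act_def
  proof (rule sum.mono_neutral_right)
    show "{a. series_of_poly m p a \<noteq> 0} \<subseteq> exponents m ` Poly_Mapping.keys p"
      using keys_series_of_poly by blast
  qed auto
  finally show ?thesis .
qed

lemma mult_series_of_poly_iff:
  "series_mult (series_of_poly m q) f = series_of_poly m p \<longleftrightarrow>
   (\<forall>es. length es = m \<longrightarrow> poly_act (series_of_poly m q) f es = series_of_poly m p es)"
proof -
  have "series_of_poly m p es = 0" if "length es \<noteq> m" for es
    using that laurent_poly_series_of_poly[of m p] by (auto simp: laurent_poly_def)
  then show ?thesis
    by (auto simp: fun_eq_iff series_mult_laurent_poly[OF laurent_poly_series_of_poly])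
qed

lemma is_expansion_unique:
  assumes "is_expansion m r f" "is_expansion m r f'"
  shows "f = f'"
proof
  fix es
  note lp = laurent_poly_series_of_poly
  let ?s = "series_of_poly m"
  from assms(1) obtain p q where f: "iterated_laurent m f" "q \<in> mpolys m" "q \<noteq> 0" "r = Fract p q"
    "\<And>es. length es = m \<Longrightarrow> poly_act (?s q) f es = ?s p es"
    by (auto simp: is_expansion_def mult_series_of_poly_iff)
  from assms(2) obtain p' q' where f': "iterated_laurent m f'" "q' \<in> mpolys m" "q' \<noteq> 0" "r = Fract p' q'"
    "\<And>es. length es = m \<Longrightarrow> poly_act (?s q') f' es = ?s p' es"
    by (auto simp: is_expansion_def mult_series_of_poly_iff)
  obtain a a' where a: "?s q a \<noteq> 0" "?s q' a' \<noteq> 0"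
    using series_of_poly_nonzero f(2,3) f'(2,3) by metis
  have eq: "q * p' = q' * p" using f(3,4) f'(3,4) by (simp add: eq_fract mult.commute)
  define g where "g = (\<lambda>es. f es - f' es)"
  have g: "iterated_laurent m g" unfolding g_def by (rule iterated_laurent_diff[OF f(1) f'(1)])
  define h where "h = (\<lambda>es. if length es = m then poly_act (?s q') g es else 0)"
  have h: "iterated_laurent m h" unfolding h_def by (rule iterated_laurent_act[OF lp g])
  have "poly_act (?s q) h es = 0" if es: "length es = m" for es
  proof -
    have "poly_act (?s q) h es = poly_act (?s q) (poly_act (?s q') g) es"
      by (rule poly_act_cong[OF lp es]) (simp add: h_def)
    also have "\<dots> = poly_act (?s q) (\<lambda>es. poly_act (?s q') f es - poly_act (?s q') f' es) es"
      by (simp add: g_def poly_act_diff[abs_def])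
    also have "\<dots> = poly_act (?s q) (poly_act (?s q') f) es - poly_act (?s q) (poly_act (?s q') f') es"
      by (rule poly_act_diff)
    also have "poly_act (?s q) (poly_act (?s q') f) es = poly_act (?s q') (poly_act (?s q) f) es"
      by (rule poly_act_commute)
    also have "\<dots> = poly_act (?s q') (?s p) es"
      by (rule poly_act_cong[OF lp es]) (rule f(5))
    also have "poly_act (?s q) (poly_act (?s q') f') es = poly_act (?s q) (?s p') es"
      by (rule poly_act_cong[OF lp es]) (rule f'(5))
    also have "poly_act (?s q') (?s p) es - poly_act (?s q) (?s p') es = 0"
      using es eq by (simp flip: series_of_poly_mult)
    finally show ?thesis .
  qed
  then have "h es = 0" for es by (rule poly_act_eq_0D[OF lp a(1) h])
  then have "poly_act (?s q') g es = 0" if "length es = m" for es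
    using that unfolding h_def by metis
  then have "g es = 0" by (rule poly_act_eq_0D[OF lp a(2) g])
  then show "f es = f' es" by (simp add: g_def)
qed

lemma expansion_ex1:
  assumes "p \<in> mpolys m" "q \<in> mpolys m" "q \<noteq> 0"
  shows "\<exists>!f. is_expansion m (Fract p q) f"
proof -
  obtain a where "series_of_poly m q a \<noteq> 0" using assms(2,3) by (rule series_of_poly_nonzero)
  from poly_act_solvable[OF laurent_poly_series_of_poly this
      iterated_laurent_laurent_poly[OF laurent_poly_series_of_poly[of m p]]]
  have "\<exists>f. is_expansion m (Fract p q) f"
    unfolding is_expansion_def mult_series_of_poly_iff using assms by blast
  then show ?thesis using is_expansion_unique by blast
qed

lemma expansion_eqI:
  assumes "iterated_laurent m f" "p \<in> mpolys m" "q \<in> mpolys m" "q \<noteq> 0" "r = Fract p q"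
    and "series_mult (series_of_poly m q) f = series_of_poly m p"
  shows "expansion m r = f"
  unfolding expansion_def
proof (rule the_equality)
  show "is_expansion m r f" using assms unfolding is_expansion_def by blast
  then show "g = f" if "is_expansion m r g" for g using that is_expansion_unique by blast
qed

end

theory Submission
  imports Defs
begin

text \<open>
  Give a permutation \<open>\<tau>\<close> of length \<open>n\<close> the weight \<open>\<Prod>i\<le>n. v (\<lambda>\<^sub>i)\<close>, where \<open>\<lambda>\<^sub>i\<close> is the length of
  a longest ascending subsequence of its first \<open>i\<close> letters, and let \<open>W\<^sub>n(v)\<close> be the sum of the
  weights over \<open>\<SS>\<^sub>n\<^sup>(\<^sup>m\<^sup>)\<close>.  Inserting the greatest letter at the sites with \<open>\<lambda>\<^sub>i = j\<close> is a
  telescoping operation; with \<open>v 0 = 1\<close> and \<open>v j = 1 / y\<^sub>j\<close> it gives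
    \<open>W\<^sub>n\<^sub>+\<^sub>1 = (\<Sum>j. 1 / (y\<^sub>j - y\<^sub>j\<^sub>-\<^sub>1)) W\<^sub>n - (\<Sum>j\<ge>2. 1 / (y\<^sub>j - y\<^sub>j\<^sub>-\<^sub>1) W\<^sub>n[y\<^sub>j\<^sub>-\<^sub>1 := y\<^sub>j])\<close>.
  Put \<open>y\<^sub>j = x\<^sub>p\<^sub>(\<^sub>1\<^sub>) + \<dots> + x\<^sub>p\<^sub>(\<^sub>j\<^sub>)\<close>, multiply by \<open>\<Prod>x\<^sub>p\<^sub>(\<^sub>j\<^sub>)\<^sup>j\<close> and antisymmetrise over \<open>p\<close>: the
  correction terms cancel in pairs, hence
    \<open>det(x\<^sub>j\<^sup>i\<^sup>-\<^sup>j) (\<Sum>1 / x\<^sub>j)\<^sup>n = (\<Sum>p. sgn p \<cdot> (\<Prod>x\<^sub>p\<^sub>(\<^sub>j\<^sub>)\<^sup>j / x\<^sub>j\<^sup>j) \<cdot> W\<^sub>n)\<close>.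
  For \<open>p = id\<close> we have \<open>y\<^sub>j = z\<^sub>j\<close>, so each \<open>\<tau>\<close> contributes one admissible monomial.  For
  \<open>p \<noteq> id\<close> with least moved point \<open>i\<close>, every exponent \<open>e\<close> in the expansion has \<open>e\<^sub>i \<ge> 0\<close>
  and \<open>(\<Sum>q>i. e\<^sub>q) < 0\<close>, so \<open>\<Lambda>\<close> annihilates the term.  These two bounds are additive over
  factors; for the inverse of a linear form \<open>z\<^sub>P + (\<Sum>q<P. c\<^sub>q z\<^sub>q)\<close> they follow by lexicographic
  induction on the support.
\<close>

section \<open>Longest ascending subsequences\<close>

definition lis :: "'a::linorder list \<Rightarrow> nat" where
  "lis xs = Max (length ` {\<sigma>. subseq \<sigma> xs \<and> sorted_wrt (<) \<sigma>})"

lemma finite_ascending_subseqs: "finite {\<sigma>. subseq \<sigma> xs \<and> sorted_wrt (<) \<sigma>}"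
  by (rule finite_subset[of _ "set (subseqs xs)"]) auto

lemma length_le_lis:
  assumes "subseq \<sigma> xs" "sorted_wrt (<) \<sigma>"
  shows "length \<sigma> \<le> lis xs"
  unfolding lis_def using assms finite_ascending_subseqs by (intro Max_ge) auto

lemma lis_witness:
  obtains \<sigma> where "subseq \<sigma> xs" "sorted_wrt (<) \<sigma>" "length \<sigma> = lis xs"
proof -
  have "lis xs \<in> length ` {\<sigma>. subseq \<sigma> xs \<and> sorted_wrt (<) \<sigma>}"
    unfolding lis_def
  proof (rule Max_in)
    show "length ` {\<sigma>. subseq \<sigma> xs \<and> sorted_wrt (<) \<sigma>} \<noteq> {}"
      using list_emb_Nil sorted_wrt.simps(1) by blast
  qed (simp add: finite_ascending_subseqs)
  with that show thesis by auto
qed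

lemma has_ascending_subseq_iff: "has_ascending_subseq k \<tau> \<longleftrightarrow> k \<le> lis \<tau>"
proof
  assume "has_ascending_subseq k \<tau>"
  then show "k \<le> lis \<tau>" by (auto simp: has_ascending_subseq_def intro: length_le_lis)
next
  assume k: "k \<le> lis \<tau>"
  obtain \<sigma> where \<sigma>: "subseq \<sigma> \<tau>" "sorted_wrt (<) \<sigma>" "length \<sigma> = lis \<tau>" by (rule lis_witness)
  have "subseq (take k \<sigma>) \<tau>"
    by (rule subseq_order.trans[OF _ \<sigma>(1)]) (simp add: prefix_imp_subseq take_is_prefix)
  with \<sigma> k show "has_ascending_subseq k \<tau>"
    unfolding has_ascending_subseq_def by (intro exI[of _ "take k \<sigma>"]) (auto simp: sorted_wrt_take)
qed

lemma lis_Nil [simp]: "lis [] = 0"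
proof -
  obtain \<sigma> :: "'a list" where "subseq \<sigma> []" "length \<sigma> = lis ([] :: 'a list)" by (rule lis_witness)
  then show ?thesis using list_emb_length by fastforce
qed

lemma lis_subseq: "subseq xs ys \<Longrightarrow> lis xs \<le> lis ys"
  by (rule lis_witness[of xs]) (metis length_le_lis subseq_order.trans)

lemma lis_take_mono: "i \<le> j \<Longrightarrow> lis (take i xs) \<le> lis (take j xs)"
proof -
  assume "i \<le> j"
  then have "take i xs = take i (take j xs)" by (simp add: min_absorb1)
  then have "prefix (take i xs) (take j xs)" by (metis take_is_prefix)
  then show ?thesis by (intro lis_subseq prefix_imp_subseq)
qed

lemma lis_snoc_le: "lis (xs @ [x]) \<le> Suc (lis xs)"
proof -
  obtain \<sigma> where \<sigma>: "subseq \<sigma> (xs @ [x])" "sorted_wrt (<) \<sigma>" "length \<sigma> = lis (xs @ [x])"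
    by (rule lis_witness)
  from \<sigma>(1) obtain s t where st: "\<sigma> = s @ t" "subseq s xs" "subseq t [x]"
    by (auto simp: subseq_append_iff)
  have "length s \<le> lis xs" using st \<sigma>(2) by (intro length_le_lis) (auto simp: sorted_wrt_append)
  moreover have "length t \<le> 1" using list_emb_length[OF st(3)] by simp
  ultimately show ?thesis using \<sigma>(3) st(1) by simp
qed

lemma subseq_imp_subset: "subseq xs ys \<Longrightarrow> set xs \<subseteq> set ys"
  by (auto elim: list_emb_set)

text \<open>An ascending subsequence through \<open>a\<close> must end there, so it is an ascending
  subsequence of \<open>xs\<close> followed by \<open>a\<close>; any other lies in
  \<open>xs @ ys\<close>.\<close>

lemma lis_insert_greatest:
  assumes "\<And>y. y \<in> set xs \<union> set ys \<Longrightarrow> y < a"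
  shows "lis (xs @ a # ys) = max (lis (xs @ ys)) (Suc (lis xs))"
proof (rule antisym)
  obtain \<sigma> where \<sigma>: "subseq \<sigma> (xs @ a # ys)" "sorted_wrt (<) \<sigma>" "length \<sigma> = lis (xs @ a # ys)"
    by (rule lis_witness)
  from \<sigma>(1) obtain s t where st: "\<sigma> = s @ t" "subseq s xs" "subseq t (a # ys)"
    by (auto simp: subseq_append_iff)
  from st(3) consider "subseq t ys" | t' where "t = a # t'" "subseq t' ys"
    by (cases t) (auto split: if_splits)
  then show "lis (xs @ a # ys) \<le> max (lis (xs @ ys)) (Suc (lis xs))"
  proof cases
    case 1
    then have "subseq \<sigma> (xs @ ys)" using st by (auto intro: list_emb_append_mono)
    then show ?thesis using length_le_lis \<sigma> by fastforce
  next
    case 2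
    have "t' = []"
    proof (rule ccontr)
      assume "t' \<noteq> []"
      then obtain b where b: "b \<in> set t'" by (cases t') auto
      then have "b \<in> set ys" using subseq_imp_subset[OF 2(2)] by blast
      then have "b < a" using assms by blast
      moreover have "sorted_wrt (<) (s @ a # t')" using \<sigma>(2) st(1) 2(1) by simp
      then have "a < b" using b by (simp add: sorted_wrt_append)
      ultimately show False by simp
    qed
    moreover have "length s \<le> lis xs"
      using st \<sigma>(2) by (intro length_le_lis) (auto simp: sorted_wrt_append)
    ultimately show ?thesis using 2 st(1) \<sigma>(3) by simp
  qed
next
  obtain \<sigma> where \<sigma>: "subseq \<sigma> xs" "sorted_wrt (<) \<sigma>" "length \<sigma> = lis xs" by (rule lis_witness)
  have "set \<sigma> \<subseteq> set xs" using \<sigma>(1) by (rule subseq_imp_subset)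
  then have "sorted_wrt (<) (\<sigma> @ [a])" using \<sigma>(2) assms by (auto simp: sorted_wrt_append)
  moreover have "subseq (\<sigma> @ [a]) (xs @ a # ys)"
    using \<sigma>(1) by (intro list_emb_append_mono) auto
  ultimately have "length (\<sigma> @ [a]) \<le> lis (xs @ a # ys)" by (intro length_le_lis)
  moreover have "lis (xs @ ys) \<le> lis (xs @ a # ys)"
    by (intro lis_subseq list_emb_append_mono) auto
  ultimately show "max (lis (xs @ ys)) (Suc (lis xs)) \<le> lis (xs @ a # ys)" using \<sigma>(3) by simp
qed

lemma lis_take_pos: "0 < i \<Longrightarrow> xs \<noteq> [] \<Longrightarrow> 0 < lis (take i xs)"
  using length_le_lis[of "[hd xs]" "take i xs"] by (cases xs; cases i) auto

text \<open>Each further letter raises \<open>lis\<close> by at most one, so no value is skipped.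
  This later rules out a zero exponent in front of a nonzero one.\<close>

lemma lis_take_intermediate:
  assumes "0 < j" "j \<le> lis (take i xs)"
  obtains k where "k \<le> i" "lis (take k xs) = j"
proof -
  have "\<exists>k\<le>i. lis (take k xs) = j" using assms(2)
  proof (induction i)
    case 0
    then show ?case using assms(1) by simp
  next
    case (Suc i)
    show ?case
    proof (cases "j \<le> lis (take i xs)")
      case True
      then show ?thesis using Suc.IH le_SucI by blast
    next
      case False
      then have "i < length xs" using Suc.prems by (cases "i < length xs") auto
      then have "lis (take (Suc i) xs) \<le> Suc (lis (take i xs))"
        by (simp add: take_Suc_conv_app_nth lis_snoc_le)
      then show ?thesis using False Suc.prems by (intro exI[of _ "Suc i"]) auto
    qed
  qed
  with that show thesis by blast
qed


section \<open>Inserting the greatest entry\<close>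

definition insert_at :: "nat \<Rightarrow> 'a \<Rightarrow> 'a list \<Rightarrow> 'a list" where
  "insert_at i a xs = take i xs @ a # drop i xs"

lemma take_insert_at_le: "k \<le> i \<Longrightarrow> i \<le> length xs \<Longrightarrow> take k (insert_at i a xs) = take k xs"
  by (simp add: insert_at_def min_absorb1)

lemma take_insert_at_Suc:
  "i \<le> k \<Longrightarrow> i \<le> length xs \<Longrightarrow> take (Suc k) (insert_at i a xs) = take i xs @ a # drop i (take k xs)"
  by (auto simp: insert_at_def drop_take le_iff_add)

lemma lis_take_insert_at:
  assumes "i \<le> k" "i \<le> length xs" "\<And>y. y \<in> set xs \<Longrightarrow> y < a"
  shows "lis (take (Suc k) (insert_at i a xs)) = max (lis (take k xs)) (Suc (lis (take i xs)))"
proof -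
  have "take i xs @ drop i (take k xs) = take k xs"
    using assms(1) by (metis append_take_drop_id min.absorb1 take_take)
  moreover have "lis (take i xs @ a # drop i (take k xs)) =
      max (lis (take i xs @ drop i (take k xs))) (Suc (lis (take i xs)))"
    by (intro lis_insert_greatest assms(3)) (auto dest: in_set_takeD in_set_dropD)
  ultimately show ?thesis
    using assms(1,2) by (simp add: take_insert_at_Suc)
qed

text \<open>One factor for each prefix, the empty one included, hence one for each site where a
  letter can be inserted. Nonempty prefixes have positive \<open>lis\<close>, so \<open>v 0\<close>
  occurs exactly once.\<close>

definition wt :: "(nat \<Rightarrow> 'b) \<Rightarrow> 'a::linorder list \<Rightarrow> 'b::comm_monoid_mult" where
  "wt v xs = (\<Prod>i\<le>length xs. v (lis (take i xs)))"

text \<open>Up to length \<open>i\<close> the prefixes are unchanged; a prefix of length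
  \<open>Suc k\<close> with \<open>i \<le> k\<close> is the old one of length \<open>k\<close> with
  \<open>a\<close> inserted. The index \<open>i\<close> therefore occurs in both products.\<close>

lemma wt_insert_at:
  assumes i: "i \<le> length xs" and a: "\<And>y. y \<in> set xs \<Longrightarrow> y < a"
  shows "wt v (insert_at i a xs) = (\<Prod>k\<le>i. v (lis (take k xs))) *
     (\<Prod>k\<in>{i..length xs}. v (max (lis (take k xs)) (Suc (lis (take i xs)))))"
proof -
  have len: "length (insert_at i a xs) = Suc (length xs)"
    using i by (simp add: insert_at_def)
  have "{..Suc (length xs)} = {..i} \<union> {Suc i..Suc (length xs)}" using i by auto
  then have "wt v (insert_at i a xs) = (\<Prod>k\<le>i. v (lis (take k (insert_at i a xs)))) *
     (\<Prod>k\<in>{Suc i..Suc (length xs)}. v (lis (take k (insert_at i a xs))))"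
    unfolding wt_def len by (simp add: prod.union_disjoint)
  also have "(\<Prod>k\<le>i. v (lis (take k (insert_at i a xs)))) = (\<Prod>k\<le>i. v (lis (take k xs)))"
    using i by (intro prod.cong) (auto simp: take_insert_at_le)
  also have "(\<Prod>k\<in>{Suc i..Suc (length xs)}. v (lis (take k (insert_at i a xs)))) =
     (\<Prod>k\<in>{i..length xs}. v (lis (take (Suc k) (insert_at i a xs))))"
    by (rule prod.shift_bounds_cl_Suc_ivl)
  also have "\<dots> = (\<Prod>k\<in>{i..length xs}. v (max (lis (take k xs)) (Suc (lis (take i xs)))))"
    using i a by (intro prod.cong) (auto simp: lis_take_insert_at)
  finally show ?thesis .
qed

text \<open>Nonempty prefixes of \<open>xs\<close> already have positive \<open>lis\<close>, so
  \<open>a\<close> in front raises none of them; the only new factor belongs to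
  \<open>[a]\<close>.\<close>

lemma wt_insert_at_front:
  assumes "\<And>y. y \<in> set xs \<Longrightarrow> y < a"
  shows "wt v (insert_at 0 a xs) = v (Suc 0) * wt v xs"
proof -
  have "(\<Prod>k\<in>{0..length xs}. v (max (lis (take k xs)) (Suc 0))) =
      v (Suc 0) * (\<Prod>k\<in>{Suc 0..length xs}. v (lis (take k xs)))"
  proof -
    have "max (lis (take k xs)) (Suc 0) = lis (take k xs)" if "k \<in> {Suc 0..length xs}" for k
      using that lis_take_pos[of k xs] by (cases xs) (auto simp: max_def)
    then show ?thesis by (subst prod.atLeast_Suc_atMost) (auto intro!: prod.cong)
  qed
  moreover have "wt v xs = v 0 * (\<Prod>k\<in>{Suc 0..length xs}. v (lis (take k xs)))"
    unfolding wt_def atMost_atLeast0 by (subst prod.atLeast_Suc_atMost) auto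
  ultimately show ?thesis
    using wt_insert_at[of 0 xs a v] assms by (simp add: mult_ac)
qed

text \<open>
  Let \<open>P i\<close> be the weight of \<open>xs\<close> in which \<open>v j\<close> is replaced by \<open>v (Suc j)\<close> from the prefix
  of length \<open>i\<close> on.  The weight after insertion at a site \<open>i\<close> with \<open>lis (take i xs) = j\<close> is
  \<open>v j * P i\<close>, which is proportional to \<open>P (Suc i) - P i\<close>.
\<close>

lemma sum_wt_insert_at:
  fixes v :: "nat \<Rightarrow> 'b::field"
  assumes a: "\<And>y. y \<in> set xs \<Longrightarrow> y < a" and neq: "v j \<noteq> v (Suc j)"
  shows "(\<Sum>i | i \<le> length xs \<and> lis (take i xs) = j. wt v (insert_at i a xs)) =
    v j * v (Suc j) / (v j - v (Suc j)) * (wt v xs - wt (v(j := v (Suc j))) xs)"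
proof -
  define n where "n = length xs"
  define l where "l = (\<lambda>i. lis (take i xs))"
  define v' where "v' = v(j := v (Suc j))"
  define P where "P = (\<lambda>i. (\<Prod>k<i. v (l k)) * (\<Prod>k\<in>{i..n}. v' (l k)))"
  let ?c = "v j * v (Suc j) / (v j - v (Suc j))"
  have step: "?c * (P (Suc i) - P i) = (if l i = j then wt v (insert_at i a xs) else 0)"
    if i: "i \<le> n" for i
  proof -
    have P_i: "P i = (\<Prod>k<i. v (l k)) * v' (l i) * (\<Prod>k\<in>{Suc i..n}. v' (l k))"
      unfolding P_def prod.atLeast_Suc_atMost[OF i] by (simp add: mult.assoc)
    have P_Suc: "P (Suc i) = (\<Prod>k<i. v (l k)) * v (l i) * (\<Prod>k\<in>{Suc i..n}. v' (l k))"
      by (simp add: P_def)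
    show ?thesis
    proof (cases "l i = j")
      case True
      \<comment> \<open>From site \<open>i\<close> on, \<open>lis\<close> is at least
        \<open>j\<close>, so the maximum with \<open>Suc j\<close> only turns the value
        \<open>j\<close> into \<open>Suc j\<close>, exactly as \<open>v'\<close> does.\<close>
      have "v (max (l k) (Suc j)) = v' (l k)" if "k \<in> {i..n}" for k
        using that lis_take_mono[of i k xs] True by (auto simp: v'_def l_def max_def le_Suc_eq)
      then have "wt v (insert_at i a xs) = (\<Prod>k\<le>i. v (l k)) * (\<Prod>k\<in>{i..n}. v' (l k))"
        using wt_insert_at[of i xs a v] i a True by (simp add: l_def n_def)
      also have "\<dots> = v j * P i" by (simp add: P_def True flip: lessThan_Suc_atMost)
      also have "\<dots> = ?c * (P (Suc i) - P i)"
        using neq by (simp add: P_i P_Suc True v'_def field_simps)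
      finally show ?thesis using True by simp
    next
      case False
      then show ?thesis by (simp add: P_i P_Suc v'_def)
    qed
  qed
  have "(\<Sum>i | i \<le> n \<and> l i = j. wt v (insert_at i a xs)) =
      (\<Sum>i\<le>n. if l i = j then wt v (insert_at i a xs) else 0)"
    by (simp add: sum.inter_filter[symmetric] Collect_conj_eq atMost_def)
  also have "\<dots> = (\<Sum>i\<le>n. ?c * (P (Suc i) - P i))" by (intro sum.cong refl) (simp only: step atMost_iff)
  also have "\<dots> = ?c * (P (Suc n) - P 0)"
    unfolding sum_distrib_left[symmetric] lessThan_Suc_atMost[symmetric] sum_lessThan_telescope ..
  also have "P (Suc n) = wt v xs"
    by (simp add: P_def wt_def n_def l_def lessThan_Suc_atMost)
  also have "P 0 = wt v' xs"
    by (simp add: P_def wt_def n_def l_def atMost_atLeast0)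
  finally show ?thesis by (simp add: n_def l_def v'_def)
qed

section \<open>Recursion in the length for the weighted sums\<close>

definition perms_no_asc_of :: "nat \<Rightarrow> nat \<Rightarrow> nat list set" where
  "perms_no_asc_of m n = {\<tau>. \<tau> \<in> perms_no_asc m \<and> length \<tau> = n}"

lemma perms_no_asc_of_iff:
  "\<tau> \<in> perms_no_asc_of m n \<longleftrightarrow> set \<tau> = {1..n} \<and> distinct \<tau> \<and> lis \<tau> \<le> m"
proof -
  have "length \<tau> = n" if "set \<tau> = {1..n}" "distinct \<tau>"
    using that by (metis card_atLeastAtMost diff_Suc_1 distinct_card)
  then show ?thesis
    by (auto simp: perms_no_asc_of_def perms_no_asc_def permutations_of_set_def
          has_ascending_subseq_iff not_le)
qed

lemma length_perms_no_asc_of: "\<tau> \<in> perms_no_asc_of m n \<Longrightarrow> length \<tau> = n"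
  by (simp add: perms_no_asc_of_def)

lemma finite_perms_no_asc_of: "finite (perms_no_asc_of m n)"
  by (rule finite_subset[of _ "permutations_of_set {1..n}"])
     (auto simp: perms_no_asc_of_def perms_no_asc_def)

lemma perms_no_asc_of_0: "perms_no_asc_of m 0 = {[]}"
  by (auto simp: perms_no_asc_of_iff)

text \<open>Deleting the greatest entry \<open>Suc n\<close> inverts the insertion, so each
  permutation arises from exactly one pair of a shorter permutation and a site. By
  \<open>lis_insert_greatest\<close> the bound \<open>m\<close> survives exactly when
  \<open>lis (take i \<tau>) < m\<close>.\<close>

lemma sum_perms_no_asc_of_Suc:
  fixes g :: "nat list \<Rightarrow> 'b::comm_monoid_add"
  shows "(\<Sum>\<tau>\<in>perms_no_asc_of m (Suc n). g \<tau>) =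
    (\<Sum>\<tau>\<in>perms_no_asc_of m n. \<Sum>i | i \<le> n \<and> lis (take i \<tau>) < m. g (insert_at i (Suc n) \<tau>))"
proof -
  let ?S = "SIGMA \<tau>:perms_no_asc_of m n. {i. i \<le> n \<and> lis (take i \<tau>) < m}"
  let ?f = "\<lambda>(\<tau>, i). insert_at i (Suc n) \<tau>"
  have lis: "lis (insert_at i (Suc n) \<tau>) = max (lis \<tau>) (Suc (lis (take i \<tau>)))"
    if "set \<tau> = {1..n}" for \<tau> i
  proof -
    have "y < Suc n" if "y \<in> set (take i \<tau>) \<union> set (drop i \<tau>)" for y
      using that \<open>set \<tau> = {1..n}\<close> by (metis Un_iff atLeastAtMost_iff in_set_dropD in_set_takeD le_imp_less_Suc)
    then have "lis (take i \<tau> @ Suc n # drop i \<tau>) = max (lis (take i \<tau> @ drop i \<tau>)) (Suc (lis (take i \<tau>)))"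
      by (rule lis_insert_greatest)
    then show ?thesis by (simp add: insert_at_def)
  qed
  have inj: "inj_on ?f ?S"
  proof (rule inj_onI)
    fix a b assume ab: "a \<in> ?S" "b \<in> ?S" "?f a = ?f b"
    obtain \<tau> i \<rho> k where eq: "a = (\<tau>, i)" "b = (\<rho>, k)" by (metis surj_pair)
    then have mem: "\<tau> \<in> perms_no_asc_of m n" "\<rho> \<in> perms_no_asc_of m n" and ik: "i \<le> n" "k \<le> n"
      using ab(1,2) by auto
    from mem have notin: "Suc n \<notin> set \<tau>" "Suc n \<notin> set \<rho>" by (auto simp: perms_no_asc_of_iff)
    from mem have len: "length \<tau> = n" "length \<rho> = n" by (simp_all add: length_perms_no_asc_of)
    have "take i \<tau> @ Suc n # drop i \<tau> = take k \<rho> @ Suc n # drop k \<rho>"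
      using ab(3) eq by (simp add: insert_at_def)
    moreover have "Suc n \<notin> set (take i \<tau>)" "Suc n \<notin> set (take k \<rho>)"
      using notin by (auto dest: in_set_takeD)
    moreover have "Suc n \<notin> set (drop i \<tau>)" "Suc n \<notin> set (drop k \<rho>)"
      using notin by (auto dest: in_set_dropD)
    ultimately have *: "take i \<tau> = take k \<rho>" "drop i \<tau> = drop k \<rho>"
      by (auto simp: append_Cons_eq_iff)
    then have "\<tau> = \<rho>" by (metis append_take_drop_id)
    moreover have "i = k" using arg_cong[OF *(1), of length] len ik by simp
    ultimately show "a = b" using eq by simp
  qed
  have "?f ` ?S = perms_no_asc_of m (Suc n)"
  proof (intro equalityI subsetI)
    fix \<rho> assume "\<rho> \<in> ?f ` ?S"
    then obtain \<tau> i where \<rho>: "\<rho> = insert_at i (Suc n) \<tau>" and \<tau>: "\<tau> \<in> perms_no_asc_of m n"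
      and i: "i \<le> n" "lis (take i \<tau>) < m" by auto
    have "set (take i \<tau>) \<union> set (drop i \<tau>) = set \<tau>" by (metis append_take_drop_id set_append)
    moreover have "distinct (take i \<tau> @ drop i \<tau>)" using \<tau> by (simp add: perms_no_asc_of_iff)
    moreover have "Suc n \<notin> set \<tau>" using \<tau> by (auto simp: perms_no_asc_of_iff)
    ultimately have "set \<rho> = insert (Suc n) (set \<tau>)" "distinct \<rho>"
      unfolding \<rho> insert_at_def distinct_append by (auto dest: in_set_takeD in_set_dropD)
    then show "\<rho> \<in> perms_no_asc_of m (Suc n)"
      using \<tau> i lis[of \<tau> i] by (auto simp: perms_no_asc_of_iff \<rho>)
  next
    fix \<rho> assume "\<rho> \<in> perms_no_asc_of m (Suc n)"
    then have \<rho>: "set \<rho> = {1..Suc n}" "distinct \<rho>" "lis \<rho> \<le> m" by (auto simp: perms_no_asc_of_iff)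
    then have "Suc n \<in> set \<rho>" by simp
    then obtain s t where st: "\<rho> = s @ Suc n # t" by (blast dest: split_list)
    have "set (s @ t) = set \<rho> - {Suc n}" using \<rho>(2) st by auto
    then have set: "set (s @ t) = {1..n}" using \<rho>(1) by auto
    have ins: "\<rho> = insert_at (length s) (Suc n) (s @ t)" by (simp add: insert_at_def st)
    have "lis \<rho> = max (lis (s @ t)) (Suc (lis s))" using lis[OF set, of "length s"] ins by simp
    moreover have dist: "distinct (s @ t)" using \<rho>(2) st by auto
    ultimately have "s @ t \<in> perms_no_asc_of m n" "lis s < m"
      using \<rho>(3) set by (auto simp: perms_no_asc_of_iff)
    moreover from this(1) have "length (s @ t) = n" by (rule length_perms_no_asc_of)
    ultimately have "(s @ t, length s) \<in> ?S" by simp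
    then show "\<rho> \<in> ?f ` ?S" using ins by (intro image_eqI[of _ _ "(s @ t, length s)"]) simp_all
  qed
  then have "(\<Sum>\<tau>\<in>perms_no_asc_of m (Suc n). g \<tau>) = (\<Sum>(\<tau>, i)\<in>?S. g (insert_at i (Suc n) \<tau>))"
    using sum.reindex[OF inj, of g] by (simp add: case_prod_unfold)
  also have "\<dots> = (\<Sum>\<tau>\<in>perms_no_asc_of m n. \<Sum>i | i \<le> n \<and> lis (take i \<tau>) < m. g (insert_at i (Suc n) \<tau>))"
    by (rule sum.Sigma[symmetric]) (simp_all add: finite_perms_no_asc_of)
  finally show ?thesis .
qed

definition wt_sum :: "nat \<Rightarrow> nat \<Rightarrow> (nat \<Rightarrow> 'b) \<Rightarrow> 'b::comm_semiring_1" where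
  "wt_sum m n v = (\<Sum>\<tau>\<in>perms_no_asc_of m n. wt v \<tau>)"

text \<open>Sites are grouped by \<open>j = lis (take i \<tau>)\<close>. The group
  \<open>j = 0\<close> is the front site alone; every other group is evaluated by the telescoping
  sum.\<close>

lemma wt_sum_Suc:
  fixes v :: "nat \<Rightarrow> 'b::field"
  assumes "m \<ge> 1" and neq: "\<And>j. 1 \<le> j \<Longrightarrow> j < m \<Longrightarrow> v j \<noteq> v (Suc j)"
  shows "wt_sum m (Suc n) v = v 1 * wt_sum m n v +
    (\<Sum>j\<in>{1..<m}. v j * v (Suc j) / (v j - v (Suc j)) *
       (wt_sum m n v - wt_sum m n (v(j := v (Suc j)))))"
proof -
  have sites: "(\<Sum>i | i \<le> n \<and> lis (take i \<tau>) < m. wt v (insert_at i (Suc n) \<tau>)) = v 1 * wt v \<tau> +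
    (\<Sum>j\<in>{1..<m}. v j * v (Suc j) / (v j - v (Suc j)) * (wt v \<tau> - wt (v(j := v (Suc j))) \<tau>))"
    if \<tau>: "\<tau> \<in> perms_no_asc_of m n" for \<tau>
  proof -
    let ?l = "\<lambda>i. lis (take i \<tau>)"
    have len: "length \<tau> = n" using \<tau> by (rule length_perms_no_asc_of)
    have less: "\<And>y. y \<in> set \<tau> \<Longrightarrow> y < Suc n"
      using \<tau> by (auto simp: perms_no_asc_of_iff)
    have "(\<Sum>i | i \<le> n \<and> ?l i < m. wt v (insert_at i (Suc n) \<tau>)) =
        (\<Sum>j\<in>{..<m}. \<Sum>i\<in>{i\<in>{i. i \<le> n \<and> ?l i < m}. ?l i = j}. wt v (insert_at i (Suc n) \<tau>))"
      by (rule sum.group[symmetric]) auto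
    also have "\<dots> = (\<Sum>j\<in>{..<m}. \<Sum>i | i \<le> n \<and> ?l i = j. wt v (insert_at i (Suc n) \<tau>))"
      by (intro sum.cong) auto
    also have "{..<m} = insert 0 {1..<m}" using assms(1) by auto
    also have "(\<Sum>j\<in>insert 0 {1..<m}. \<Sum>i | i \<le> n \<and> ?l i = j. wt v (insert_at i (Suc n) \<tau>)) =
        (\<Sum>i | i \<le> n \<and> ?l i = 0. wt v (insert_at i (Suc n) \<tau>)) +
        (\<Sum>j\<in>{1..<m}. \<Sum>i | i \<le> n \<and> ?l i = j. wt v (insert_at i (Suc n) \<tau>))"
      by simp
    also have "{i. i \<le> n \<and> ?l i = 0} = {0}"
      using lis_take_pos[of _ \<tau>] len by force
    also have "(\<Sum>i\<in>{0}. wt v (insert_at i (Suc n) \<tau>)) = v 1 * wt v \<tau>"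
      using wt_insert_at_front[OF less] by simp
    also have "(\<Sum>j\<in>{1..<m}. \<Sum>i | i \<le> n \<and> ?l i = j. wt v (insert_at i (Suc n) \<tau>)) =
      (\<Sum>j\<in>{1..<m}. v j * v (Suc j) / (v j - v (Suc j)) * (wt v \<tau> - wt (v(j := v (Suc j))) \<tau>))"
      using sum_wt_insert_at[of \<tau> "Suc n" v] less neq len by (intro sum.cong refl) auto
    finally show ?thesis .
  qed
  have swap: "(\<Sum>\<tau>\<in>perms_no_asc_of m n. \<Sum>j\<in>{1..<m}. c j * (wt v \<tau> - wt (w j) \<tau>)) =
      (\<Sum>j\<in>{1..<m}. c j * (wt_sum m n v - wt_sum m n (w j)))" for c w
    unfolding wt_sum_def sum_subtractf[symmetric] sum_distrib_left by (rule sum.swap)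
  have "wt_sum m (Suc n) v = (\<Sum>\<tau>\<in>perms_no_asc_of m n. v 1 * wt v \<tau> +
    (\<Sum>j\<in>{1..<m}. v j * v (Suc j) / (v j - v (Suc j)) * (wt v \<tau> - wt (v(j := v (Suc j))) \<tau>)))"
    unfolding wt_sum_def sum_perms_no_asc_of_Suc by (intro sum.cong refl sites)
  also have "\<dots> = v 1 * wt_sum m n v + (\<Sum>j\<in>{1..<m}. v j * v (Suc j) / (v j - v (Suc j)) *
       (wt_sum m n v - wt_sum m n (v(j := v (Suc j)))))"
    unfolding sum.distrib swap by (simp add: wt_sum_def sum_distrib_left)
  finally show ?thesis .
qed

section \<open>The alternating sum\<close>

text \<open>
  The value at \<open>0\<close> is \<open>1\<close>, not \<open>inverse 0\<close>: the empty prefix carries no variable.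
\<close>

definition partial_sum_weight :: "(nat \<Rightarrow> 'a) \<Rightarrow> (nat \<Rightarrow> nat) \<Rightarrow> nat \<Rightarrow> 'a::field" where
  "partial_sum_weight X p j = (if j = 0 then 1 else inverse (\<Sum>l<j. X (p l)))"

definition alternating_sum :: "nat \<Rightarrow> (nat \<Rightarrow> 'a) \<Rightarrow> nat \<Rightarrow> 'a::field" where
  "alternating_sum m X n = (\<Sum>p | p permutes {..<m}. of_int (sign p) * (\<Prod>l<m. X (p l) ^ l) *
     wt_sum m n (partial_sum_weight X p))"

lemma prod_eq_remove2:
  assumes "finite A" "i \<in> A" "j \<in> A" "i \<noteq> j"
  shows "prod g A = g i * g j * prod g (A - {i, j})"
proof -
  have "prod g A = g i * prod g (A - {i})" using assms by (intro prod.remove)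
  also have "prod g (A - {i}) = g j * prod g (A - {i} - {j})" using assms by (intro prod.remove) auto
  also have "A - {i} - {j} = A - {i, j}" by auto
  finally show ?thesis by (simp add: mult.assoc)
qed

lemma eq_uminus_imp_0: "x = - x \<Longrightarrow> x = 0" for x :: "'a::field_char_0"
  by (simp add: eq_neg_iff_add_eq_0 flip: mult_2)

lemma inverse_mult_over_diff:
  fixes a b :: "'a::field"
  assumes "a \<noteq> 0" "b \<noteq> 0" "a \<noteq> b"
  shows "inverse a * inverse b / (inverse a - inverse b) = 1 / (b - a)"
proof -
  have "inverse a - inverse b = (b - a) * (inverse a * inverse b)"
    using assms by (simp add: field_simps)
  then show ?thesis using assms by simp
qed

text \<open>
  The exponents \<open>l\<close> of \<open>X (p l)\<close> are chosen so that dividing the product by \<open>X (p j)\<close> makes it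
  symmetric in \<open>X (p (j - 1))\<close> and \<open>X (p j)\<close>; the correction term of index \<open>j\<close> does not
  involve the partial sum of length \<open>j\<close>, the only one that is not symmetric in these two.
\<close>

lemma alternating_correction_eq_0:
  fixes X :: "nat \<Rightarrow> 'a::field_char_0"
  assumes nz: "\<And>l. l < m \<Longrightarrow> X l \<noteq> 0" and j: "1 \<le> j" "j < m"
  defines "w \<equiv> partial_sum_weight X"
  shows "(\<Sum>p | p permutes {..<m}. of_int (sign p) * (\<Prod>l<m. X (p l) ^ l) *
     (1 / X (p j) * wt_sum m n ((w p)(j := w p (Suc j))))) = 0" (is "?S = 0")
proof -
  define t where "t = transpose (j - 1) j"
  let ?h = "\<lambda>p. of_int (sign p) * (\<Prod>l<m. X (p l) ^ l) *
     (1 / X (p j) * wt_sum m n ((w p)(j := w p (Suc j))))"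
  have t: "t permutes {..<m}" unfolding t_def using j by (intro permutes_swap_id) auto
  have "?h (p \<circ> t) = - ?h p" if p: "p permutes {..<m}" for p
  proof -
    have "permutation p" "permutation t"
      using p t permutation_permutes by (metis finite_lessThan)+
    then have sgn: "sign (p \<circ> t) = - sign p"
      using j by (simp add: sign_compose t_def sign_swap_id)
    have t_simps: "t (j - Suc 0) = j" "t j = j - 1" "\<And>l. l \<noteq> j - 1 \<Longrightarrow> l \<noteq> j \<Longrightarrow> t l = l"
      using j by (auto simp: t_def transpose_def)
    have pj: "X (p j) \<noteq> 0" "X (p (j - 1)) \<noteq> 0"
      using nz permutes_in_image[OF p] j by auto
    have weight: "w (p \<circ> t) k = w p k" if "k \<noteq> j" for k
    proof -
      have "t permutes {..<k}" if "j < k"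
        unfolding t_def using that by (intro permutes_swap_id) auto
      moreover have "t l = l" if "k < j" "l < k" for l using that by (intro t_simps) auto
      ultimately have "(\<Sum>l<k. X (p (t l))) = (\<Sum>l<k. X (p l))"
        using \<open>k \<noteq> j\<close> sum.permute[of t "{..<k}" "\<lambda>l. X (p l)"]
        by (cases "j < k") (auto simp: o_def intro!: sum.cong)
      then show ?thesis by (simp add: w_def partial_sum_weight_def)
    qed
    have eq_w: "(w (p \<circ> t))(j := w (p \<circ> t) (Suc j)) = (w p)(j := w p (Suc j))"
      by (auto simp: fun_eq_iff weight)
    have eq_X: "(\<Prod>l<m. X ((p \<circ> t) l) ^ l) * (1 / X ((p \<circ> t) j)) =
        (\<Prod>l<m. X (p l) ^ l) * (1 / X (p j))"
    proof -
      have split: "prod g {..<m} = g (j - 1) * g j * prod g ({..<m} - {j - 1, j})"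
        for g :: "nat \<Rightarrow> 'a" using j by (intro prod_eq_remove2) auto
      have "(\<Prod>l\<in>{..<m} - {j - 1, j}. X ((p \<circ> t) l) ^ l) = (\<Prod>l\<in>{..<m} - {j - 1, j}. X (p l) ^ l)"
        by (intro prod.cong) (auto simp: t_simps)
      moreover have pow: "y ^ j = y * y ^ (j - 1)" for y :: 'a
        using j by (cases j) auto
      ultimately show ?thesis
        unfolding split[of "\<lambda>l. X ((p \<circ> t) l) ^ l"] split[of "\<lambda>l. X (p l) ^ l"]
        using pj by (simp add: t_simps pow)
    qed
    have "?h (p \<circ> t) = of_int (sign (p \<circ> t)) * ((\<Prod>l<m. X ((p \<circ> t) l) ^ l) * (1 / X ((p \<circ> t) j)) *
        wt_sum m n ((w (p \<circ> t))(j := w (p \<circ> t) (Suc j))))"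
      by (simp only: mult.assoc)
    also have "\<dots> = of_int (- sign p) * ((\<Prod>l<m. X (p l) ^ l) * (1 / X (p j)) *
        wt_sum m n ((w p)(j := w p (Suc j))))"
      by (simp only: eq_w eq_X sgn)
    also have "\<dots> = - ?h p" by (simp only: mult.assoc of_int_minus mult_minus_left)
    finally show ?thesis .
  qed
  then have "(\<Sum>p | p permutes {..<m}. ?h (p \<circ> t)) = - ?S"
    by (simp add: sum_negf)
  moreover have "(\<Sum>p | p permutes {..<m}. ?h (p \<circ> t)) = ?S"
    by (rule sum_permutations_compose_right[OF t, symmetric])
  ultimately have "?S = - ?S" by (simp only:)
  then show ?thesis by (rule eq_uminus_imp_0)
qed

text \<open>For these weights the coefficient of index \<open>j\<close> in \<open>wt_sum_Suc\<close>
  is \<open>1 / X (p j)\<close>, and \<open>w p 1\<close> supplies the missing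
  \<open>1 / X (p 0)\<close>. The main parts thus share a factor independent of \<open>p\<close>,
  while the corrections cancel in the alternating sum.\<close>

lemma alternating_sum_Suc:
  fixes X :: "nat \<Rightarrow> 'a::field_char_0"
  assumes m: "m \<ge> 1" and nz: "\<And>I. I \<subseteq> {..<m} \<Longrightarrow> I \<noteq> {} \<Longrightarrow> sum X I \<noteq> 0"
  shows "alternating_sum m X (Suc n) = (\<Sum>l<m. 1 / X l) * alternating_sum m X n"
proof -
  define w where "w = partial_sum_weight X"
  define c where "c = (\<lambda>p. of_int (sign p) * (\<Prod>l<m. X (p l) ^ l))"
  have nz1: "X l \<noteq> 0" if "l < m" for l using nz[of "{l}"] that by simp
  have step: "wt_sum m (Suc n) (w p) = (\<Sum>l<m. 1 / X l) * wt_sum m n (w p) -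
      (\<Sum>j\<in>{1..<m}. 1 / X (p j) * wt_sum m n ((w p)(j := w p (Suc j))))"
    if p: "p permutes {..<m}" for p
  proof -
    let ?Y = "\<lambda>j. \<Sum>l<j. X (p l)"
    \<comment> \<open>A permutation can send the first \<open>j\<close> positions to any
      \<open>j\<close> indices; hence the assumption on sums over arbitrary nonempty
      \<open>I\<close>.\<close>
    have Y: "?Y j \<noteq> 0" if "1 \<le> j" "j \<le> m" for j
    proof -
      have "p ` {..<j} \<subseteq> p ` {..<m}" using that by (intro image_mono) simp
      then have "p ` {..<j} \<subseteq> {..<m}" by (simp add: permutes_image[OF p])
      moreover have "p ` {..<j} \<noteq> {}" using that by (simp add: lessThan_empty_iff)
      ultimately have "sum X (p ` {..<j}) \<noteq> 0" by (rule nz)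
      then show ?thesis by (simp add: sum.reindex permutes_inj_on[OF p] o_def)
    qed
    have Xp: "X (p j) \<noteq> 0" if "j < m" for j
      using nz1[of "p j"] permutes_in_image[OF p, of j] that by simp
    have diff: "w p j * w p (Suc j) / (w p j - w p (Suc j)) = 1 / X (p j)" "w p j \<noteq> w p (Suc j)"
      if "1 \<le> j" "j < m" for j
    proof -
      have *: "?Y j \<noteq> 0" "?Y j + X (p j) \<noteq> 0" "X (p j) \<noteq> 0"
        using Y[of j] Y[of "Suc j"] Xp[of j] that by auto
      have w: "w p j = inverse (?Y j)" "w p (Suc j) = inverse (?Y j + X (p j))"
        using that by (auto simp: w_def partial_sum_weight_def)
      show "w p j * w p (Suc j) / (w p j - w p (Suc j)) = 1 / X (p j)"
        unfolding w by (subst inverse_mult_over_diff) (use * in auto)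
      show "w p j \<noteq> w p (Suc j)" using * by (simp add: w)
    qed
    have inv: "(\<Sum>l<m. 1 / X l) = (\<Sum>l<m. 1 / X (p l))"
      using sum.permute[OF p, of "\<lambda>l. 1 / X l"] by (simp add: o_def)
    have "{..<m} = insert 0 {1..<m}" using m by auto
    then have inv': "(\<Sum>l<m. 1 / X (p l)) = w p 1 + (\<Sum>j\<in>{1..<m}. 1 / X (p j))"
      by (simp add: w_def partial_sum_weight_def inverse_eq_divide)
    have "wt_sum m (Suc n) (w p) = w p 1 * wt_sum m n (w p) +
      (\<Sum>j\<in>{1..<m}. 1 / X (p j) * (wt_sum m n (w p) - wt_sum m n ((w p)(j := w p (Suc j)))))"
      using wt_sum_Suc[OF m, of "w p" n] diff by simp
    then show ?thesis
      unfolding inv inv' by (simp add: algebra_simps sum_subtractf sum_distrib_left sum_distrib_right)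
  qed
  have distrib: "(\<Sum>p\<in>A. c p * (s * E p - (\<Sum>j\<in>B. g p j))) =
      s * (\<Sum>p\<in>A. c p * E p) - (\<Sum>j\<in>B. \<Sum>p\<in>A. c p * g p j)"
    for A and B :: "nat set" and s E g
    by (subst sum.swap)
       (simp add: right_diff_distrib sum_subtractf sum_distrib_left mult.left_commute)
  have "alternating_sum m X (Suc n) = (\<Sum>p | p permutes {..<m}. c p * ((\<Sum>l<m. 1 / X l) * wt_sum m n (w p) -
      (\<Sum>j\<in>{1..<m}. 1 / X (p j) * wt_sum m n ((w p)(j := w p (Suc j))))))"
    unfolding alternating_sum_def c_def w_def[symmetric] by (intro sum.cong refl) (simp add: step)
  also have "\<dots> = (\<Sum>l<m. 1 / X l) * alternating_sum m X n - (\<Sum>j\<in>{1..<m}.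
      \<Sum>p | p permutes {..<m}. c p * (1 / X (p j) * wt_sum m n ((w p)(j := w p (Suc j)))))"
    unfolding distrib by (simp only: alternating_sum_def c_def w_def)
  also have "(\<Sum>j\<in>{1..<m}. \<Sum>p | p permutes {..<m}.
      c p * (1 / X (p j) * wt_sum m n ((w p)(j := w p (Suc j))))) = 0"
    unfolding c_def w_def using nz1 by (intro sum.neutral ballI alternating_correction_eq_0) auto
  finally show ?thesis by simp
qed

text \<open>Only the empty permutation is left, with weight \<open>1\<close>; the right-hand side is
  a Vandermonde determinant.\<close>

lemma alternating_sum_0: "alternating_sum m X 0 =
    (\<Sum>p | p permutes {..<m}. of_int (sign p) * (\<Prod>l<m. X (p l) ^ l))"
  by (simp add: alternating_sum_def wt_sum_def perms_no_asc_of_0 wt_def partial_sum_weight_def)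

lemma alternating_sum_eq:
  fixes X :: "nat \<Rightarrow> 'a::field_char_0"
  assumes "m \<ge> 1" "\<And>I. I \<subseteq> {..<m} \<Longrightarrow> I \<noteq> {} \<Longrightarrow> sum X I \<noteq> 0"
  shows "alternating_sum m X n = (\<Sum>l<m. 1 / X l) ^ n * alternating_sum m X 0"
  by (induction n) (simp_all add: alternating_sum_Suc[OF assms])

section \<open>Leibniz expansion of the determinant\<close>

lemma signof_eq_sign: "p permutes {..<m} \<Longrightarrow> signof p = of_int (sign p)"
  by (simp add: sign_def)

text \<open>The denominators \<open>X (p l) ^ p l\<close> multiply to a product that, after
  reindexing by \<open>p\<close>, is the same for all permutations.\<close>

lemma prod_power_quotient:
  fixes X :: "nat \<Rightarrow> 'a::field"
  assumes p: "p permutes {..<m}" and nz: "\<And>l. l < m \<Longrightarrow> X l \<noteq> 0"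
  shows "(\<Prod>l<m. X (p l) powi (int l - int (p l))) = (\<Prod>l<m. X (p l) ^ l) / (\<Prod>l<m. X l ^ l)"
proof -
  have "X (p l) powi (int l - int (p l)) = X (p l) ^ l / X (p l) ^ p l" if "l < m" for l
    using nz permutes_in_image[OF p, of l] that by (simp add: power_int_diff)
  then have "(\<Prod>l<m. X (p l) powi (int l - int (p l))) = (\<Prod>l<m. X (p l) ^ l / X (p l) ^ p l)"
    by simp
  also have "\<dots> = (\<Prod>l<m. X (p l) ^ l) / (\<Prod>l<m. X (p l) ^ p l)"
    by (rule prod_dividef)
  also have "(\<Prod>l<m. X (p l) ^ p l) = (\<Prod>l<m. X l ^ l)"
    using prod.permute[OF p, of "\<lambda>l. X l ^ l"] by (simp add: o_def)
  finally show ?thesis .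
qed

text \<open>The determinant is \<open>alternating_sum m X 0\<close> divided by the fixed product
  \<open>?M\<close>, and the power of the sum of reciprocals raises the index \<open>0\<close> to
  \<open>n\<close>. Each summand on the right is, up to sign, a single product of powers and
  inverses of linear forms.\<close>

lemma det_power_times_power_sum:
  fixes X :: "nat \<Rightarrow> 'a::field_char_0"
  assumes m: "m \<ge> 1" and nz: "\<And>I. I \<subseteq> {..<m} \<Longrightarrow> I \<noteq> {} \<Longrightarrow> sum X I \<noteq> 0"
  shows "det (mat m m (\<lambda>(i, j). X j powi (int i - int j))) * (\<Sum>l<m. 1 / X l) ^ n =
    (\<Sum>p | p permutes {..<m}. \<Sum>\<tau>\<in>perms_no_asc_of m n. of_int (sign p) *
       ((\<Prod>l<m. X (p l) powi (int l - int (p l))) * wt (partial_sum_weight X p) \<tau>))"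
proof -
  have nz1: "X l \<noteq> 0" if "l < m" for l using nz[of "{l}"] that by simp
  let ?M = "\<Prod>l<m. X l ^ l"
  have "det (mat m m (\<lambda>(i, j). X j powi (int i - int j))) =
      (\<Sum>p | p permutes {..<m}. of_int (sign p) * (\<Prod>l<m. X (p l) powi (int l - int (p l))))"
    unfolding det_def'[OF mat_carrier] atLeast0LessThan
  proof (rule sum.cong)
    fix p assume "p \<in> {p. p permutes {..<m}}"
    then have p: "p permutes {..<m}" by simp
    then have "mat m m (\<lambda>(i, j). X j powi (int i - int j)) $$ (l, p l) = X (p l) powi (int l - int (p l))"
      if "l < m" for l
      using that permutes_in_image[OF p, of l] by simp
    then show "signof p * (\<Prod>l<m. mat m m (\<lambda>(i, j). X j powi (int i - int j)) $$ (l, p l)) =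
      of_int (sign p) * (\<Prod>l<m. X (p l) powi (int l - int (p l)))"
      using signof_eq_sign[OF p] by simp
  qed simp
  also have "\<dots> = alternating_sum m X 0 / ?M"
    by (simp add: alternating_sum_0 prod_power_quotient nz1 sum_divide_distrib)
  also have "alternating_sum m X 0 / ?M * (\<Sum>l<m. 1 / X l) ^ n = alternating_sum m X n / ?M"
    by (simp add: alternating_sum_eq[OF m nz, of n])
  also have "\<dots> = (\<Sum>p | p permutes {..<m}. \<Sum>\<tau>\<in>perms_no_asc_of m n. of_int (sign p) *
       ((\<Prod>l<m. X (p l) powi (int l - int (p l))) * wt (partial_sum_weight X p) \<tau>))"
    unfolding alternating_sum_def wt_sum_def sum_divide_distrib sum_distrib_left
    by (intro sum.cong refl) (simp add: prod_power_quotient nz1 mult.assoc)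
  finally show ?thesis .
qed

section \<open>Polynomials and rational functions in the first \<open>m\<close> variables\<close>

lemma mpolys_0: "0 \<in> mpolys m"
  by (simp add: mpolys_def)

lemma mpolys_single: "Poly_Mapping.keys k \<subseteq> {1..m} \<Longrightarrow> Poly_Mapping.single k c \<in> mpolys m"
  by (simp add: mpolys_def)

lemma mpolys_1: "1 \<in> mpolys m"
  using mpolys_single[of 0 m 1] by simp

lemma mpolys_add: "p \<in> mpolys m \<Longrightarrow> q \<in> mpolys m \<Longrightarrow> p + q \<in> mpolys m"
  using Poly_Mapping.keys_add[of p q] unfolding mpolys_def by blast

lemma mpolys_diff: "p \<in> mpolys m \<Longrightarrow> q \<in> mpolys m \<Longrightarrow> p - q \<in> mpolys m"
  using keys_diff[of p q] unfolding mpolys_def by blast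

lemma mpolys_mult:
  assumes "p \<in> mpolys m" "q \<in> mpolys m"
  shows "p * q \<in> mpolys m"
  unfolding mpolys_def
proof (intro CollectI ballI)
  fix k assume "k \<in> Poly_Mapping.keys (p * q)"
  then obtain a b where ab: "k = a + b" "a \<in> Poly_Mapping.keys p" "b \<in> Poly_Mapping.keys q"
    using keys_mult[of p q] by blast
  then have "Poly_Mapping.keys a \<subseteq> {1..m}" "Poly_Mapping.keys b \<subseteq> {1..m}"
    using assms by (auto simp: mpolys_def)
  then show "Poly_Mapping.keys k \<subseteq> {1..m}"
    unfolding ab(1) using Poly_Mapping.keys_add[of a b] by blast
qed

definition ratfuns :: "nat \<Rightarrow> ratfun set" where
  "ratfuns m = {Fract p q | p q. p \<in> mpolys m \<and> q \<in> mpolys m \<and> q \<noteq> 0}"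

lemma ratfuns_cases:
  assumes "r \<in> ratfuns m"
  obtains p q where "r = Fract p q" "p \<in> mpolys m" "q \<in> mpolys m" "q \<noteq> 0"
  using assms by (auto simp: ratfuns_def)

lemma ratfunsI: "p \<in> mpolys m \<Longrightarrow> q \<in> mpolys m \<Longrightarrow> q \<noteq> 0 \<Longrightarrow> Fract p q \<in> ratfuns m"
  by (auto simp: ratfuns_def)

lemma ratfuns_0: "0 \<in> ratfuns m"
  unfolding Zero_fract_def by (intro ratfunsI mpolys_0 mpolys_1) simp

lemma ratfuns_1: "1 \<in> ratfuns m"
  unfolding One_fract_def by (intro ratfunsI mpolys_1) simp

lemma ratfuns_add: "r \<in> ratfuns m \<Longrightarrow> s \<in> ratfuns m \<Longrightarrow> r + s \<in> ratfuns m"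
  by (elim ratfuns_cases) (auto intro!: ratfunsI mpolys_add mpolys_mult)

lemma ratfuns_diff: "r \<in> ratfuns m \<Longrightarrow> s \<in> ratfuns m \<Longrightarrow> r - s \<in> ratfuns m"
  by (elim ratfuns_cases) (auto intro!: ratfunsI mpolys_diff mpolys_mult)

lemma ratfuns_mult: "r \<in> ratfuns m \<Longrightarrow> s \<in> ratfuns m \<Longrightarrow> r * s \<in> ratfuns m"
  by (elim ratfuns_cases) (auto intro!: ratfunsI mpolys_mult)

lemma ratfuns_inverse:
  assumes "r \<in> ratfuns m"
  shows "inverse r \<in> ratfuns m"
proof -
  obtain p q where "r = Fract p q" "p \<in> mpolys m" "q \<in> mpolys m" "q \<noteq> 0"
    using assms by (rule ratfuns_cases)
  then show ?thesis
    using ratfuns_0 by (cases "p = 0") (auto simp: fract_collapse intro: ratfunsI)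
qed

lemma ratfuns_divide: "r \<in> ratfuns m \<Longrightarrow> s \<in> ratfuns m \<Longrightarrow> r / s \<in> ratfuns m"
  unfolding divide_inverse by (intro ratfuns_mult ratfuns_inverse)

lemma ratfuns_sum: "(\<And>i. i \<in> I \<Longrightarrow> r i \<in> ratfuns m) \<Longrightarrow> sum r I \<in> ratfuns m"
  by (induction I rule: infinite_finite_induct) (auto intro: ratfuns_0 ratfuns_add)

lemma ratfuns_z_var: "j \<le> m \<Longrightarrow> z_var j \<in> ratfuns m"
  unfolding z_var_def by (auto intro!: ratfuns_0 ratfunsI mpolys_single mpolys_1)

lemma ratfuns_x_diff: "j \<le> m \<Longrightarrow> x_diff j \<in> ratfuns m"
  unfolding x_diff_def by (intro ratfuns_diff ratfuns_z_var) auto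


section \<open>Arithmetic of expansions\<close>

lemma is_expansion_FractI:
  assumes "iterated_laurent m f" "p \<in> mpolys m" "q \<in> mpolys m" "q \<noteq> 0"
    and "\<And>es. length es = m \<Longrightarrow> poly_act (series_of_poly m q) f es = series_of_poly m p es"
  shows "is_expansion m (Fract p q) f"
  unfolding is_expansion_def mult_series_of_poly_iff using assms by blast

lemma is_expansion_iterated_laurent: "is_expansion m r f \<Longrightarrow> iterated_laurent m f"
  by (simp add: is_expansion_def)

lemma is_expansion_length: "is_expansion m r f \<Longrightarrow> f es \<noteq> 0 \<Longrightarrow> length es = m"
  by (auto dest: is_expansion_iterated_laurent iterated_laurent_length)

lemma is_expansion_ratfuns: "is_expansion m r f \<Longrightarrow> r \<in> ratfuns m"
  by (auto simp: is_expansion_def intro: ratfunsI)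

text \<open>\<open>is_expansion\<close> provides only some representing fraction; uniqueness of the
  expansion carries the defining equation over to every other one.\<close>

lemma is_expansion_FractD:
  assumes f: "is_expansion m (Fract p q) f" and pq: "p \<in> mpolys m" "q \<in> mpolys m" "q \<noteq> 0"
    and "length es = m"
  shows "poly_act (series_of_poly m q) f es = series_of_poly m p es"
proof -
  obtain a where "series_of_poly m q a \<noteq> 0" using pq(2,3) by (rule series_of_poly_nonzero)
  from poly_act_solvable[OF laurent_poly_series_of_poly this
      iterated_laurent_laurent_poly[OF laurent_poly_series_of_poly[of m p]]]
  obtain g where g: "iterated_laurent m g"
    "\<And>es. length es = m \<Longrightarrow> poly_act (series_of_poly m q) g es = series_of_poly m p es" by blast
  with pq have "is_expansion m (Fract p q) g" by (intro is_expansion_FractI)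
  with f have "f = g" by (rule is_expansion_unique)
  with g(2) assms(5) show ?thesis by simp
qed

lemma is_expansion_exists: "r \<in> ratfuns m \<Longrightarrow> \<exists>f. is_expansion m r f"
  by (elim ratfuns_cases) (use expansion_ex1 in blast)

lemma expansion_eq: "is_expansion m r f \<Longrightarrow> expansion m r = f"
  unfolding expansion_def using is_expansion_unique by blast

lemma is_expansion_expansion: "r \<in> ratfuns m \<Longrightarrow> is_expansion m r (expansion m r)"
  using is_expansion_exists expansion_eq by blast

lemma is_expansion_0: "is_expansion m 0 (\<lambda>_. 0)"
  unfolding Zero_fract_def
  by (intro is_expansion_FractI iterated_laurent_zero mpolys_0 mpolys_1)
     (simp_all add: poly_act_zero series_of_poly_zero)

lemma is_expansion_diff:
  assumes f: "is_expansion m r f" and g: "is_expansion m s g"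
  shows "is_expansion m (r - s) (\<lambda>es. f es - g es)"
proof -
  obtain p q where pq: "r = Fract p q" "p \<in> mpolys m" "q \<in> mpolys m" "q \<noteq> 0"
    using is_expansion_ratfuns[OF f] by (rule ratfuns_cases)
  obtain p' q' where pq': "s = Fract p' q'" "p' \<in> mpolys m" "q' \<in> mpolys m" "q' \<noteq> 0"
    using is_expansion_ratfuns[OF g] by (rule ratfuns_cases)
  have r: "r = Fract (p * q') (q * q')" and s: "s = Fract (p' * q) (q * q')"
    using pq pq' by (auto simp: eq_fract algebra_simps)
  have nz: "q * q' \<noteq> 0" using pq pq' by simp
  note mem = mpolys_mult[OF pq(2) pq'(3)] mpolys_mult[OF pq'(2) pq(3)] mpolys_mult[OF pq(3) pq'(3)]
  have "r - s = Fract (p * q' - p' * q) (q * q')"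
    using pq pq' by simp
  moreover have "is_expansion m (Fract (p * q' - p' * q) (q * q')) (\<lambda>es. f es - g es)"
  proof (rule is_expansion_FractI)
    show "iterated_laurent m (\<lambda>es. f es - g es)"
      using f g by (intro iterated_laurent_diff is_expansion_iterated_laurent)
    fix es :: "int list" assume es: "length es = m"
    have "series_of_poly m (p * q') es = series_of_poly m (p * q' - p' * q) es + series_of_poly m (p' * q) es"
      by (simp flip: series_of_poly_add)
    moreover have "poly_act (series_of_poly m (q * q')) f es = series_of_poly m (p * q') es"
      using f es nz mem unfolding r by (intro is_expansion_FractD)
    moreover have "poly_act (series_of_poly m (q * q')) g es = series_of_poly m (p' * q) es"
      using g es nz mem unfolding s by (intro is_expansion_FractD)
    ultimately show "poly_act (series_of_poly m (q * q')) (\<lambda>es. f es - g es) es =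
        series_of_poly m (p * q' - p' * q) es"
      by (simp add: poly_act_diff)
  qed (use mem nz mpolys_diff in auto)
  ultimately show ?thesis by simp
qed

lemma is_expansion_add:
  assumes "is_expansion m r f" "is_expansion m s g"
  shows "is_expansion m (r + s) (\<lambda>es. f es + g es)"
  using is_expansion_diff[OF assms(1) is_expansion_diff[OF is_expansion_0 assms(2)]] by simp

lemma is_expansion_sum:
  "(\<And>i. i \<in> I \<Longrightarrow> is_expansion m (r i) (f i)) \<Longrightarrow> is_expansion m (sum r I) (\<lambda>es. \<Sum>i\<in>I. f i es)"
  by (induction I rule: infinite_finite_induct) (auto intro: is_expansion_0 is_expansion_add)

text \<open>This is the zero list unless \<open>1 \<le> j \<le> m\<close>.\<close>

definition unit_exp :: "nat \<Rightarrow> nat \<Rightarrow> int list" where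
  "unit_exp m j = exponents m (Poly_Mapping.single j 1)"

lemma length_unit_exp [simp]: "length (unit_exp m j) = m"
  by (simp add: unit_exp_def length_exponents)

lemma nth_unit_exp: "i < m \<Longrightarrow> unit_exp m j ! i = (if Suc i = j then 1 else 0)"
  by (simp add: unit_exp_def exponents_def lookup_single when_def del: upt_Suc)

text \<open>The action of multiplication by \<open>z_var j\<close> on coefficients; the zero value
  at \<open>j = 0\<close> matches \<open>z_var 0 = 0\<close>.\<close>

definition z_shift :: "nat \<Rightarrow> nat \<Rightarrow> (int list \<Rightarrow> rat) \<Rightarrow> int list \<Rightarrow> rat" where
  "z_shift m j f es = (if 1 \<le> j \<and> length es = m then f (map2 (-) es (unit_exp m j)) else 0)"

lemma is_expansion_z_var_mult:
  assumes f: "is_expansion m r f" and j: "j \<le> m"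
  shows "is_expansion m (z_var j * r) (z_shift m j f)"
proof (cases "j = 0")
  case True
  then have "z_shift m j f = (\<lambda>_. 0)" by (simp add: z_shift_def fun_eq_iff)
  with True show ?thesis by (simp add: z_var_def is_expansion_0)
next
  case False
  define x :: qpoly where "x = Poly_Mapping.single (Poly_Mapping.single j 1) 1"
  have x: "x \<in> mpolys m" unfolding x_def using False j by (intro mpolys_single) auto
  obtain p q where pq: "r = Fract p q" "p \<in> mpolys m" "q \<in> mpolys m" "q \<noteq> 0"
    using is_expansion_ratfuns[OF f] by (rule ratfuns_cases)
  have "series_of_poly m x a = (if a = unit_exp m j then 1 else 0)" for a
    unfolding x_def series_of_poly_single unit_exp_def when_def by auto
  then have act: "poly_act (series_of_poly m x) g es = g (map2 (-) es (unit_exp m j))" for g es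
    by (simp add: poly_act_def)
  have "is_expansion m (Fract (x * p) q) (z_shift m j f)"
  proof (rule is_expansion_FractI)
    show "iterated_laurent m (z_shift m j f)"
      using iterated_laurent_shift[OF is_expansion_iterated_laurent[OF f] length_unit_exp[of m j]] False
      by (simp add: z_shift_def[abs_def])
    fix es :: "int list" assume es: "length es = m"
    have "poly_act (series_of_poly m q) (z_shift m j f) es =
        poly_act (series_of_poly m q) (poly_act (series_of_poly m x) f) es"
      using es False by (intro poly_act_cong[OF laurent_poly_series_of_poly]) (simp_all add: z_shift_def act)
    also have "\<dots> = poly_act (series_of_poly m x) (poly_act (series_of_poly m q) f) es"
      by (rule poly_act_commute)
    also have "\<dots> = poly_act (series_of_poly m x) (series_of_poly m p) es"
      using es f pq by (intro poly_act_cong[OF laurent_poly_series_of_poly] is_expansion_FractD) simp_all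
    also have "\<dots> = series_of_poly m (x * p) es"
      using es by (simp add: series_of_poly_mult)
    finally show "poly_act (series_of_poly m q) (z_shift m j f) es = series_of_poly m (x * p) es" .
  qed (use pq x mpolys_mult in auto)
  moreover have "z_var j * r = Fract (x * p) q" using False by (simp add: z_var_def x_def pq(1))
  ultimately show ?thesis by simp
qed

lemma is_expansion_x_diff_mult:
  assumes "is_expansion m r f" "j \<le> m"
  shows "is_expansion m (x_diff j * r) (\<lambda>es. z_shift m j f es - z_shift m (j - 1) f es)"
  unfolding x_diff_def left_diff_distrib
  using assms by (intro is_expansion_diff is_expansion_z_var_mult) auto


section \<open>Weighted lower bounds on exponents\<close>

text \<open>Positions count from \<open>0\<close>, so \<open>w l\<close> belongs to
  \<open>z_var (Suc l)\<close>. Two functionals occur in the end: the entry at one position, and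
  minus the sum of all entries after it.\<close>

definition exp_weight :: "(nat \<Rightarrow> int) \<Rightarrow> int list \<Rightarrow> int" where
  "exp_weight w es = (\<Sum>i<length es. w i * es ! i)"

lemma weight_delta: "l < m \<Longrightarrow> (\<Sum>i<m. w i * (if i = l then 1 else 0)) = (w l :: int)" for l m :: nat
  by (subst sum.cong[OF refl, of _ _ "\<lambda>i. if i = l then w i else 0"]) auto

lemma exp_weight_minus_unit:
  "length es = m \<Longrightarrow> l < m \<Longrightarrow> exp_weight w (map2 (-) es (unit_exp m (Suc l))) = exp_weight w es - w l"
  by (simp add: exp_weight_def nth_unit_exp right_diff_distrib sum_subtractf weight_delta)

lemma exp_weight_plus_unit:
  "length es = m \<Longrightarrow> l < m \<Longrightarrow> exp_weight w (map2 (+) es (unit_exp m (Suc l))) = exp_weight w es + w l"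
  by (simp add: exp_weight_def nth_unit_exp distrib_left sum.distrib weight_delta)

definition exp_bound :: "nat \<Rightarrow> (nat \<Rightarrow> int) \<Rightarrow> int \<Rightarrow> ratfun \<Rightarrow> bool" where
  "exp_bound m w c r \<longleftrightarrow> (\<exists>f. is_expansion m r f \<and> (\<forall>es. f es \<noteq> 0 \<longrightarrow> c \<le> exp_weight w es))"

lemma exp_boundI:
  "is_expansion m r f \<Longrightarrow> (\<And>es. f es \<noteq> 0 \<Longrightarrow> c \<le> exp_weight w es) \<Longrightarrow> exp_bound m w c r"
  by (auto simp: exp_bound_def)

lemma exp_boundD:
  "exp_bound m w c r \<Longrightarrow> expansion m r es \<noteq> 0 \<Longrightarrow> c \<le> exp_weight w es"
  by (auto simp: exp_bound_def expansion_eq)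

lemma exp_bound_ratfuns: "exp_bound m w c r \<Longrightarrow> r \<in> ratfuns m"
  by (auto simp: exp_bound_def is_expansion_ratfuns)

lemma exp_bound_mono: "exp_bound m w c r \<Longrightarrow> d \<le> c \<Longrightarrow> exp_bound m w d r"
  by (auto simp: exp_bound_def intro: order_trans)

lemma exp_bound_1: "exp_bound m w 0 1"
proof (rule exp_boundI)
  have s1: "series_of_poly m 1 = (\<lambda>es. if es = replicate m 0 then 1 else 0)"
  proof
    have "exponents m 0 = replicate m 0"
      by (simp add: exponents_def map_replicate_const)
    then show "series_of_poly m 1 es = (if es = replicate m 0 then 1 else 0)" for es
      using series_of_poly_single[of m 0 1 es] by (simp add: when_def eq_commute)
  qed
  show "is_expansion m 1 (series_of_poly m 1)"
    unfolding One_fract_def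
  proof (rule is_expansion_FractI)
    show "poly_act (series_of_poly m 1) (series_of_poly m 1) es = series_of_poly m 1 es"
      if "length es = m" for es
      using series_of_poly_mult[OF that, of 1 1] by simp
  qed (auto intro: mpolys_1 iterated_laurent_laurent_poly laurent_poly_series_of_poly)
  show "0 \<le> exp_weight w es" if "series_of_poly m 1 es \<noteq> 0" for es
    using that by (auto simp: s1 exp_weight_def split: if_splits)
qed

text \<open>The two variables in \<open>x_diff (Suc l)\<close> add a unit at position
  \<open>l\<close> or \<open>l - 1\<close>, which changes the weight by at least \<open>d\<close>;
  for \<open>l = 0\<close> the second variable is zero.\<close>

lemma exp_bound_x_diff_mult:
  assumes r: "exp_bound m w c r" and l: "l < m" and d: "\<And>q. q \<le> l \<Longrightarrow> d \<le> w q"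
  shows "exp_bound m w (c + d) (x_diff (Suc l) * r)"
proof -
  obtain f where f: "is_expansion m r f" "\<And>es. f es \<noteq> 0 \<Longrightarrow> c \<le> exp_weight w es"
    using r by (auto simp: exp_bound_def)
  have shift: "c + d \<le> exp_weight w es" if "z_shift m j f es \<noteq> 0" "j \<le> Suc l" for j es
  proof -
    from that have es: "1 \<le> j" "length es = m" "f (map2 (-) es (unit_exp m j)) \<noteq> 0"
      by (auto simp: z_shift_def split: if_splits)
    then obtain q where q: "j = Suc q" by (cases j) auto
    then have "c \<le> exp_weight w es - w q"
      using f(2)[OF es(3)] exp_weight_minus_unit[OF es(2)] l that by simp
    moreover have "d \<le> w q" using q that by (intro d) auto
    ultimately show ?thesis by simp
  qed
  show ?thesis
  proof (rule exp_boundI)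
    show "is_expansion m (x_diff (Suc l) * r) (\<lambda>es. z_shift m (Suc l) f es - z_shift m l f es)"
      using is_expansion_x_diff_mult[OF f(1), of "Suc l"] l by simp
    fix es assume "z_shift m (Suc l) f es - z_shift m l f es \<noteq> 0"
    then show "c + d \<le> exp_weight w es" using shift[of "Suc l" es] shift[of l es]
      by (cases "z_shift m l f es = 0") auto
  qed
qed

text \<open>
  The support of an iterated Laurent series is well-ordered lexicographically, although the
  lexicographic order on all exponent lists is not well-founded.
\<close>

lemma iterated_laurent_lex_induct:
  assumes "iterated_laurent m f"
    and "\<And>es. f es \<noteq> 0 \<Longrightarrow> (\<And>es'. f es' \<noteq> 0 \<Longrightarrow> (es', es) \<in> lex {(x, y). x < y} \<Longrightarrow> P es') \<Longrightarrow> P es"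
    and "f es \<noteq> 0"
  shows "P es"
  using assms
proof (induction m arbitrary: f P es)
  case 0
  have "(es', es) \<notin> lex {(x, y). x < y}" if "f es' \<noteq> 0" for es'
  proof -
    have "es = []" "es' = []" using 0(1,3) that by auto
    then show ?thesis by simp
  qed
  then show ?case using 0(2,3) by blast
next
  case (Suc m)
  obtain N where N: "\<And>e es. e < N \<Longrightarrow> f (e # es) = 0"
    using Suc.prems(1) by (rule iterated_laurent_bound) blast
  \<comment> \<open>Heads are bounded below by \<open>N\<close>. A smaller head is handled by
    induction on its distance \<open>k\<close> from \<open>N\<close>, an equal head by the induction
    on \<open>m\<close> applied to the tails.\<close>
  have *: "\<forall>es. f ((N + int k) # es) \<noteq> 0 \<longrightarrow> P ((N + int k) # es)" for k
  proof (induction k rule: less_induct)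
    case (less k)
    have low: "P (e # es)" if "e < N + int k" "f (e # es) \<noteq> 0" for e es
    proof -
      have "\<not> e < N" using N that by auto
      then show ?thesis using less.IH[of "nat (e - N)"] that by simp
    qed
    show ?case
    proof (intro allI impI)
      fix es assume es: "f ((N + int k) # es) \<noteq> 0"
      show "P ((N + int k) # es)"
      proof (rule Suc.IH[of "\<lambda>es. f ((N + int k) # es)" "\<lambda>es. P ((N + int k) # es)"])
        show "iterated_laurent m (\<lambda>es. f ((N + int k) # es))"
          using Suc.prems(1) by (rule iterated_laurent_SucD)
        show "f ((N + int k) # es) \<noteq> 0" by (rule es)
        fix t
        assume t: "f ((N + int k) # t) \<noteq> 0"
          and IH: "\<And>t'. f ((N + int k) # t') \<noteq> 0 \<Longrightarrow> (t', t) \<in> lex {(x, y). x < y} \<Longrightarrow> P ((N + int k) # t')"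
        show "P ((N + int k) # t)"
        proof (rule Suc.prems(2)[OF t])
          fix es' assume es': "f es' \<noteq> 0" "(es', (N + int k) # t) \<in> lex {(x, y). x < y}"
          then obtain e t' where et: "es' = e # t'" by (cases es') auto
          with es'(2) have "e < N + int k \<or> e = N + int k \<and> (t', t) \<in> lex {(x, y). x < y}" by auto
          then show "P es'" using low IH es'(1) et by auto
        qed
      qed
    qed
  qed
  obtain e es' where es: "es = e # es'"
    using iterated_laurent_length[OF Suc.prems(1,3)] by (cases es) auto
  then have "\<not> e < N" using N Suc.prems(3) by auto
  then show ?case using *[of "nat (e - N)"] Suc.prems(3) es by simp
qed

lemma lex_nthI:
  assumes "length xs = length ys" "q < length ys" "\<And>i. i < q \<Longrightarrow> xs ! i = ys ! i" "(xs ! q, ys ! q) \<in> r"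
  shows "(xs, ys) \<in> lex r"
proof -
  have "take q xs = take q ys" using assms(1-3) by (intro nth_equalityI) auto
  moreover have "xs = take q xs @ xs ! q # drop (Suc q) xs" "ys = take q ys @ ys ! q # drop (Suc q) ys"
    using assms(1,2) by (simp_all add: id_take_nth_drop)
  ultimately show ?thesis
    unfolding lex_conv using assms(1,4)
    by (intro CollectI case_prodI conjI) (assumption, metis)
qed

text \<open>
  A nonempty sum of \<open>x\<^sub>j\<close>'s has the form \<open>z\<^sub>P + L'\<close> with \<open>L'\<close> a combination of \<open>z\<^sub>q\<close>,
  \<open>q < P\<close>.  If \<open>(z\<^sub>P + L') g = f\<close>, then every exponent of \<open>z\<^sub>P g\<close> is an exponent of \<open>f\<close> or
  of some \<open>z\<^sub>q g\<close>, \<open>q < P\<close>; in the latter case it arises from a lexicographically smaller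
  exponent of \<open>g\<close>.
\<close>

lemma exp_bound_divide_sum_x_diff:
  assumes r: "exp_bound m w c r" and I: "I \<subseteq> {..<m}" "I \<noteq> {}"
    and nz: "(\<Sum>l\<in>I. x_diff (Suc l)) \<noteq> 0"
    and mono: "\<And>q. q \<le> Max I \<Longrightarrow> w (Max I) \<le> w q"
  shows "exp_bound m w (c - w (Max I)) (r / (\<Sum>l\<in>I. x_diff (Suc l)))"
proof -
  define L where "L = (\<Sum>l\<in>I. x_diff (Suc l))"
  define P where "P = Max I"
  have fin: "finite I" using I(1) finite_subset by blast
  have PI: "P \<in> I" "\<And>l. l \<in> I \<Longrightarrow> l \<le> P" "P < m"
    using fin I by (auto simp: P_def subset_iff)
  have L_mem: "L \<in> ratfuns m" unfolding L_def using I by (intro ratfuns_sum ratfuns_x_diff) auto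
  obtain f where f: "is_expansion m r f" "\<And>es. f es \<noteq> 0 \<Longrightarrow> c \<le> exp_weight w es"
    using r by (auto simp: exp_bound_def)
  obtain g where g: "is_expansion m (r / L) g"
    using is_expansion_exists[OF ratfuns_divide[OF is_expansion_ratfuns[OF f(1)] L_mem]] by blast
  have "is_expansion m (\<Sum>l\<in>I. x_diff (Suc l) * (r / L))
      (\<lambda>es. \<Sum>l\<in>I. z_shift m (Suc l) g es - z_shift m l g es)"
    using is_expansion_x_diff_mult[OF g, of "Suc _"] I by (intro is_expansion_sum) auto
  moreover have "(\<Sum>l\<in>I. x_diff (Suc l) * (r / L)) = r"
    unfolding sum_distrib_right[symmetric] L_def[symmetric] using nz by (simp add: L_def)
  ultimately have "is_expansion m r (\<lambda>es. \<Sum>l\<in>I. z_shift m (Suc l) g es - z_shift m l g es)"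
    by (simp only:)
  then have "(\<lambda>es. \<Sum>l\<in>I. z_shift m (Suc l) g es - z_shift m l g es) = f"
    using f(1) by (rule is_expansion_unique)
  then have f_eq: "(\<Sum>l\<in>I. z_shift m (Suc l) g es - z_shift m l g es) = f es" for es
    by (rule fun_cong)
  show ?thesis
    unfolding L_def[symmetric] P_def[symmetric]
  proof (rule exp_boundI[OF g])
    fix es assume nz: "g es \<noteq> 0"
    show "c - w P \<le> exp_weight w es"
    proof (induction rule: iterated_laurent_lex_induct[OF is_expansion_iterated_laurent[OF g] _ nz])
      case (1 es)
      have len: "length es = m" using is_expansion_length[OF g 1(1)] .
      define es' where "es' = map2 (+) es (unit_exp m (Suc P))"
      have len': "length es' = m" by (simp add: es'_def len)
      have weight': "exp_weight w es' = exp_weight w es + w P"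
        unfolding es'_def using len PI(3) by (rule exp_weight_plus_unit)
      have "map2 (-) es' (unit_exp m (Suc P)) = es"
        by (rule nth_equalityI) (simp_all add: es'_def len)
      then have top: "z_shift m (Suc P) g es' = g es"
        by (simp add: z_shift_def len')
      show ?case
      proof (cases "f es' = 0")
        case False
        then show ?thesis using f(2) weight' by fastforce
      next
        case True
        \<comment> \<open>Otherwise only the leading term \<open>g es\<close> would remain in the
          coefficient of \<open>f\<close> at \<open>es'\<close>, which is zero.\<close>
        have "\<exists>q\<le>P. z_shift m q g es' \<noteq> 0"
        proof (rule ccontr)
          assume "\<not> ?thesis"
          then have zero: "z_shift m q g es' = 0" if "q \<le> P" for q using that by blast
          have "(\<Sum>l\<in>I. z_shift m (Suc l) g es' - z_shift m l g es') =
              (\<Sum>l\<in>I. if l = P then g es else 0)"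
          proof (rule sum.cong)
            fix l assume "l \<in> I"
            then have "l \<le> P" by (rule PI)
            then show "z_shift m (Suc l) g es' - z_shift m l g es' = (if l = P then g es else 0)"
              using zero[of l] zero[of "Suc l"] top by auto
          qed simp
          also have "\<dots> = g es" using PI(1) fin by simp
          finally show False using f_eq[of es'] True 1(1) by simp
        qed
        then obtain j where j: "j \<le> P" "z_shift m j g es' \<noteq> 0" by blast
        then have "1 \<le> j" by (simp add: z_shift_def split: if_splits)
        then obtain q where q: "j = Suc q" by (cases j) auto
        define es'' where "es'' = map2 (-) es' (unit_exp m (Suc q))"
        have g'': "g es'' \<noteq> 0" using j(2) q by (simp add: z_shift_def es''_def split: if_splits)
        have len'': "length es'' = m" by (simp add: es''_def len')
        have qP: "q < P" "q < m" using j q PI(3) by auto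
        have nth'': "es'' ! i = es ! i + (if i = P then 1 else 0) - (if i = q then 1 else 0)"
          if "i < m" for i
          using that by (simp add: es''_def es'_def len nth_unit_exp)
        \<comment> \<open>\<open>es''\<close> arises from \<open>es\<close> by moving a unit from
          \<open>q\<close> to the later position \<open>P\<close>, so it is smaller at the first
          difference.\<close>
        have "(es'', es) \<in> lex {(x, y). x < y}"
        proof (rule lex_nthI)
          show "length es'' = length es" "q < length es" using len len'' qP by auto
          show "es'' ! i = es ! i" if "i < q" for i using that qP nth''[of i] by simp
          show "(es'' ! q, es ! q) \<in> {(x, y). x < y}" using qP nth''[of q] by simp
        qed
        then have "c - w P \<le> exp_weight w es''" using g'' by (intro 1(2))
        also have "\<dots> = exp_weight w es + w P - w q"
          unfolding es''_def weight'[symmetric] using len' qP(2) by (rule exp_weight_minus_unit)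
        also have "\<dots> \<le> exp_weight w es" using mono[of q] qP by (simp add: P_def)
        finally show ?thesis .
      qed
    qed
  qed
qed

text \<open>The bound is put on multiplication by \<open>r\<close>, so that bounds for products
  follow by composition and two expansions never have to be multiplied. The case
  \<open>s = 1\<close> recovers a bound on \<open>r\<close> itself.\<close>

definition mult_bound :: "nat \<Rightarrow> (nat \<Rightarrow> int) \<Rightarrow> int \<Rightarrow> ratfun \<Rightarrow> bool" where
  "mult_bound m w c r \<longleftrightarrow> (\<forall>d s. exp_bound m w d s \<longrightarrow> exp_bound m w (d + c) (r * s))"

lemma mult_bound_imp_exp_bound: "mult_bound m w c r \<Longrightarrow> exp_bound m w c r"
  using exp_bound_1[of m w] unfolding mult_bound_def by fastforce

lemma mult_bound_mono: "mult_bound m w c r \<Longrightarrow> d \<le> c \<Longrightarrow> mult_bound m w d r"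
  unfolding mult_bound_def by (meson add_left_mono exp_bound_mono)

lemma mult_bound_1: "mult_bound m w 0 1"
  by (simp add: mult_bound_def)

lemma mult_bound_mult:
  assumes "mult_bound m w c r" "mult_bound m w d s"
  shows "mult_bound m w (c + d) (r * s)"
  unfolding mult_bound_def
proof (intro allI impI)
  fix b t assume "exp_bound m w b t"
  then have "exp_bound m w (b + d + c) (r * (s * t))"
    using assms unfolding mult_bound_def by blast
  then show "exp_bound m w (b + (c + d)) (r * s * t)" by (simp add: ac_simps)
qed

lemma mult_bound_prod:
  "(\<And>i. i \<in> I \<Longrightarrow> mult_bound m w (c i) (r i)) \<Longrightarrow> mult_bound m w (\<Sum>i\<in>I. c i) (\<Prod>i\<in>I. r i)"
  by (induction I rule: infinite_finite_induct) (auto intro: mult_bound_1 mult_bound_mult)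

lemma mult_bound_power: "mult_bound m w c r \<Longrightarrow> mult_bound m w (int n * c) (r ^ n)"
  using mult_bound_prod[of "{..<n}" m w "\<lambda>_. c" "\<lambda>_. r"] by simp

lemma mult_bound_x_diff:
  "l < m \<Longrightarrow> (\<And>q. q \<le> l \<Longrightarrow> d \<le> w q) \<Longrightarrow> mult_bound m w d (x_diff (Suc l))"
  unfolding mult_bound_def by (blast intro: exp_bound_x_diff_mult)

text \<open>The variable with index \<open>Suc (Max I)\<close> occurs only in the summand
  \<open>l = Max I\<close>, with coefficient \<open>1\<close>.\<close>

lemma sum_x_diff_neq_0:
  assumes "I \<subseteq> {..<m}" "I \<noteq> {}"
  shows "(\<Sum>l\<in>I. x_diff (Suc l)) \<noteq> 0"
proof -
  have fin: "finite I" using assms(1) finite_subset by blast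
  define zp :: "nat \<Rightarrow> qpoly" where
    "zp j = (if j = 0 then 0 else Poly_Mapping.single (Poly_Mapping.single j 1) 1)" for j
  define M where "M = Max I"
  let ?k = "Poly_Mapping.single (Suc M) (1 :: nat)"
  have single_eq: "Poly_Mapping.single j (1::nat) = ?k \<longleftrightarrow> j = Suc M" for j
    by (metis lookup_single_eq lookup_single_not_eq one_neq_zero)
  have lookup: "Poly_Mapping.lookup (zp j) ?k = (if j = Suc M then 1 else 0)" for j
    unfolding zp_def lookup_single when_def using single_eq[of j] by (simp add: lookup_single when_def)
  have x: "x_diff (Suc l) = Fract (zp (Suc l) - zp l) 1" for l
    by (simp add: x_diff_def z_var_def zp_def Zero_fract_def)
  have sum_Fract: "(\<Sum>l\<in>J. Fract (a l) 1) = Fract (sum a J) 1" for J and a :: "nat \<Rightarrow> qpoly"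
    by (induction J rule: infinite_finite_induct) (simp_all add: Zero_fract_def)
  have "Poly_Mapping.lookup (\<Sum>l\<in>I. zp (Suc l) - zp l) ?k = (\<Sum>l\<in>I. if l = M then 1 else 0)"
    unfolding lookup_sum
  proof (rule sum.cong)
    fix l assume "l \<in> I"
    then have "l \<le> M" using fin by (simp add: M_def)
    then show "Poly_Mapping.lookup (zp (Suc l) - zp l) ?k = (if l = M then 1 else 0)"
      unfolding lookup_minus lookup by simp
  qed simp
  also have "\<dots> = 1" using fin assms(2) Max_in[of I] by (simp add: M_def)
  finally have "(\<Sum>l\<in>I. zp (Suc l) - zp l) \<noteq> 0" by auto
  then show ?thesis unfolding x sum_Fract by (simp add: Zero_fract_def eq_fract)
qed

lemma mult_bound_inverse_sum_x_diff:
  assumes "I \<subseteq> {..<m}" "I \<noteq> {}" "\<And>q. q \<le> Max I \<Longrightarrow> w (Max I) \<le> w q"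
  shows "mult_bound m w (- w (Max I)) (inverse (\<Sum>l\<in>I. x_diff (Suc l)))"
  unfolding mult_bound_def
proof (intro allI impI)
  fix d s assume "exp_bound m w d s"
  from exp_bound_divide_sum_x_diff[OF this assms(1,2) sum_x_diff_neq_0[OF assms(1,2)] assms(3)]
  show "exp_bound m w (d + - w (Max I)) (inverse (\<Sum>l\<in>I. x_diff (Suc l)) * s)"
    by (simp add: divide_inverse mult.commute)
qed

text \<open>Since \<open>w l\<close> is the least weight up to position \<open>l\<close>, positive
  and negative powers obey the same formula; negative ones come from the bound for inverses with
  \<open>I = {l}\<close>.\<close>

lemma mult_bound_x_diff_powi:
  assumes l: "l < m" and mono: "\<And>q. q \<le> l \<Longrightarrow> w l \<le> w q"
  shows "mult_bound m w (e * w l) (x_diff (Suc l) powi e)"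
proof (cases "0 \<le> e")
  case True
  have "mult_bound m w (int (nat e) * w l) (x_diff (Suc l) ^ nat e)"
    using l mono by (intro mult_bound_power mult_bound_x_diff)
  then show ?thesis using True by (simp add: power_int_def)
next
  case False
  have "mult_bound m w (- w l) (inverse (x_diff (Suc l)))"
    using mult_bound_inverse_sum_x_diff[of "{l}" m w] l mono by simp
  then have "mult_bound m w (int (nat (- e)) * - w l) (inverse (x_diff (Suc l)) ^ nat (- e))"
    by (rule mult_bound_power)
  then show ?thesis using False by (simp add: power_int_def)
qed


section \<open>Evaluation of \<open>\<Lambda>\<close>\<close>

text \<open>The assumptions on \<open>w\<close> cover both functionals used later. Away from
  \<open>i\<close> the weight is minimal among the earlier positions, as the bound for inverses
  requires. At \<open>i\<close> this may fail, but no linear form with top index \<open>i\<close> is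
  ever inverted.\<close>

lemma exp_bounds_nonidentity:
  assumes p: "p permutes {..<m}" and fixed: "\<And>l. l < i \<Longrightarrow> p l = l" and i: "p i \<noteq> i"
    and \<tau>: "lis \<tau> \<le> m"
    and w: "\<And>M. M \<noteq> i \<Longrightarrow> w M \<le> 0 \<and> (\<forall>q\<le>M. w M \<le> w q)" "\<And>q. q \<le> i \<Longrightarrow> 0 \<le> w q"
  shows "exp_bound m w (\<Sum>l<m. if p l = i then 0 else (int l - int (p l)) * w (p l))
    ((\<Prod>l<m. x_diff (Suc (p l)) powi (int l - int (p l))) *
      wt (partial_sum_weight (\<lambda>l. x_diff (Suc l)) p) \<tau>)"
proof -
  have inj: "inj p" using p by (rule permutes_inj)
  \<comment> \<open>All values below \<open>i\<close> are already taken by fixed points.\<close>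
  have p_i: "i < p i"
  proof (rule ccontr)
    assume "\<not> i < p i"
    then have "p (p i) = p i" using i by (intro fixed) simp
    then show False using i inj by (auto dest: injD)
  qed
  have "mult_bound m w (if p l = i then 0 else (int l - int (p l)) * w (p l))
      (x_diff (Suc (p l)) powi (int l - int (p l)))" if l: "l < m" for l
  proof (cases "p l = i")
    case True
    \<comment> \<open>Smaller positions are fixed and cannot be sent to \<open>i\<close>. The
      exponent is therefore nonnegative, and the bound \<open>0\<close> holds because
      \<open>w\<close> is nonnegative up to \<open>i\<close>.\<close>
    have "i \<le> l" using True fixed[of l] by (cases "l < i") auto
    then have "x_diff (Suc (p l)) powi (int l - int (p l)) = x_diff (Suc i) ^ (l - i)"
      unfolding True by (simp add: power_int_def nat_diff_distrib)
    moreover have "i < m" using permutes_in_image[OF p, of l] True l by simp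
    then have "mult_bound m w (int (l - i) * 0) (x_diff (Suc i) ^ (l - i))"
      using w(2) by (intro mult_bound_power mult_bound_x_diff)
    ultimately show ?thesis using True by simp
  next
    case False
    have "p l < m" using permutes_in_image[OF p, of l] l by simp
    then have "mult_bound m w ((int l - int (p l)) * w (p l)) (x_diff (Suc (p l)) powi (int l - int (p l)))"
      using w(1)[OF False] by (intro mult_bound_x_diff_powi) auto
    then show ?thesis using False by simp
  qed
  then have "mult_bound m w (\<Sum>l<m. if p l = i then 0 else (int l - int (p l)) * w (p l))
      (\<Prod>l<m. x_diff (Suc (p l)) powi (int l - int (p l)))"
    by (intro mult_bound_prod) simp
  moreover have "mult_bound m w 0 (partial_sum_weight (\<lambda>l. x_diff (Suc l)) p j)" if j: "j \<le> m" for j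
  proof (cases "j = 0")
    case False
    define I where "I = p ` {..<j}"
    have I: "I \<subseteq> {..<m}" "I \<noteq> {}" "finite I"
    proof -
      have "I \<subseteq> p ` {..<m}" unfolding I_def using j by (intro image_mono) simp
      then show "I \<subseteq> {..<m}" by (simp add: permutes_image[OF p])
    qed (use False in \<open>auto simp: I_def lessThan_empty_iff\<close>)
    \<comment> \<open>For \<open>j \<le> i\<close> the set \<open>I\<close> lies below
      \<open>i\<close>; otherwise it contains \<open>p i\<close>, which exceeds
      \<open>i\<close>.\<close>
    have "Max I \<noteq> i"
    proof (cases "j \<le> i")
      case True
      then have "x < i" if "x \<in> I" for x using that fixed by (auto simp: I_def)
      then show ?thesis using Max_in[OF I(3,2)] by blast
    next
      case False
      then have "p i \<le> Max I" using I(3) by (intro Max_ge) (auto simp: I_def)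
      then show ?thesis using p_i by simp
    qed
    note w_I = w(1)[OF this]
    have "mult_bound m w (- w (Max I)) (inverse (\<Sum>l\<in>I. x_diff (Suc l)))"
      using I(1,2) w_I by (intro mult_bound_inverse_sum_x_diff) auto
    then have "mult_bound m w 0 (inverse (\<Sum>l\<in>I. x_diff (Suc l)))"
      by (rule mult_bound_mono) (use w_I in simp)
    then show ?thesis
      using False by (simp add: I_def partial_sum_weight_def sum.reindex inj_on_subset[OF inj] o_def)
  qed (simp add: partial_sum_weight_def mult_bound_1)
  then have "mult_bound m w 0 (wt (partial_sum_weight (\<lambda>l. x_diff (Suc l)) p) \<tau>)"
  proof -
    assume *: "\<And>j. j \<le> m \<Longrightarrow> mult_bound m w 0 (partial_sum_weight (\<lambda>l. x_diff (Suc l)) p j)"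
    have "lis (take k \<tau>) \<le> m" for k
      using lis_subseq[OF prefix_imp_subseq[OF take_is_prefix], of k \<tau>] \<tau> by simp
    then have "mult_bound m w (\<Sum>k\<le>length \<tau>. 0) (wt (partial_sum_weight (\<lambda>l. x_diff (Suc l)) p) \<tau>)"
      unfolding wt_def by (intro mult_bound_prod *)
    then show ?thesis by simp
  qed
  ultimately have "mult_bound m w ((\<Sum>l<m. if p l = i then 0 else (int l - int (p l)) * w (p l)) + 0)
    ((\<Prod>l<m. x_diff (Suc (p l)) powi (int l - int (p l))) *
      wt (partial_sum_weight (\<lambda>l. x_diff (Suc l)) p) \<tau>)"
    by (rule mult_bound_mult)
  then show ?thesis by (intro mult_bound_imp_exp_bound) simp
qed

text \<open>
  Let \<open>i\<close> be the least point moved by \<open>p\<close>.  In every exponent, the entry at \<open>i\<close> is nonnegative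
  and the sum of the later entries is negative, so no exponent is admissible.
\<close>

lemma Lam_nonidentity:
  assumes p: "p permutes {..<m}" "p \<noteq> id" and \<tau>: "lis \<tau> \<le> m"
  defines "r \<equiv> (\<Prod>l<m. x_diff (Suc (p l)) powi (int l - int (p l))) *
      wt (partial_sum_weight (\<lambda>l. x_diff (Suc l)) p) \<tau>"
  shows "r \<in> ratfuns m" "Lam m (expansion m r) = 0"
proof -
  obtain l where "p l \<noteq> l" using p(2) by (auto simp: fun_eq_iff)
  define i where "i = (LEAST l. p l \<noteq> l)"
  have i: "p i \<noteq> i" unfolding i_def using \<open>p l \<noteq> l\<close> by (rule LeastI)
  have fixed: "p l = l" if "l < i" for l using not_less_Least[OF that[unfolded i_def]] by simp
  have "i < m" using i p(1) by (metis lessThan_iff permutes_not_in)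
  have inj: "inj p" using p(1) by (rule permutes_inj)
  obtain k where k: "p k = i" using permutes_surj[OF p(1)] by (metis surjD)
  have "k < m" using permutes_in_image[OF p(1), of k] k \<open>i < m\<close> by simp
  have "i < k"
  proof (rule ccontr)
    assume "\<not> i < k"
    then have "k < i" using k i by (cases "k = i") auto
    then show False using fixed k by auto
  qed
  define w1 :: "nat \<Rightarrow> int" where "w1 = (\<lambda>q. if q = i then 1 else 0)"
  define w2 :: "nat \<Rightarrow> int" where "w2 = (\<lambda>q. if i < q then -1 else 0)"
  have "exp_bound m w1 (\<Sum>l<m. if p l = i then 0 else (int l - int (p l)) * w1 (p l)) r"
    unfolding r_def by (rule exp_bounds_nonidentity[OF p(1) fixed i \<tau>]) (auto simp: w1_def)
  also have "(\<Sum>l<m. if p l = i then 0 else (int l - int (p l)) * w1 (p l)) = 0"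
    by (intro sum.neutral) (simp add: w1_def)
  finally have bound1: "exp_bound m w1 0 r" .
  then show "r \<in> ratfuns m" by (rule exp_bound_ratfuns)
  have "exp_bound m w2 (\<Sum>l<m. if p l = i then 0 else (int l - int (p l)) * w2 (p l)) r"
    unfolding r_def by (rule exp_bounds_nonidentity[OF p(1) fixed i \<tau>]) (auto simp: w2_def)
  \<comment> \<open>The differences \<open>l - p l\<close> sum to zero over all \<open>l\<close>,
    and those with \<open>p l < i\<close> vanish because such points are fixed. Omitting the index
    \<open>k\<close> leaves \<open>k - i\<close>, which is positive.\<close>
  also have "(\<Sum>l<m. if p l = i then 0 else (int l - int (p l)) * w2 (p l)) =
      (\<Sum>l<m. (if l = k then int k - int i else 0) - (int l - int (p l)))"
  proof (rule sum.cong)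
    fix l
    consider "p l < i" "l \<noteq> k" | "p l = i" "l = k" | "i < p l" "l \<noteq> k"
      using k inj by (metis injD linorder_neqE_nat)
    then show "(if p l = i then 0 else (int l - int (p l)) * w2 (p l)) =
        (if l = k then int k - int i else 0) - (int l - int (p l))"
    proof cases
      case 1
      then have "p l = l" using fixed[of "p l"] inj by (auto dest: injD)
      then show ?thesis using 1 by simp
    qed (auto simp: w2_def)
  qed simp
  also have "\<dots> = int k - int i"
    using \<open>k < m\<close> sum.permute[OF p(1), of int] by (simp add: sum_subtractf o_def)
  finally have bound2: "exp_bound m w2 (int k - int i) r" .
  have "\<not> admissible es" if es: "length es = m" "expansion m r es \<noteq> 0" for es
  proof
    assume adm: "admissible es"
    have "exp_weight w1 es = (\<Sum>q<m. if q = i then es ! i else 0)"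
      unfolding exp_weight_def es(1) by (intro sum.cong) (auto simp: w1_def)
    then have "0 \<le> es ! i" using exp_boundD[OF bound1 es(2)] \<open>i < m\<close> by simp
    \<comment> \<open>Nonnegative by the bound for \<open>w1\<close>, nonpositive by admissibility.
      The later entries then vanish as well, against the positive bound for
      \<open>w2\<close>.\<close>
    then have "es ! i = 0" using adm \<open>i < m\<close> es(1) by (auto simp: admissible_def intro: antisym)
    then have "es ! q = 0" if "i < q" "q < m" for q
      using adm[unfolded admissible_def, rule_format, of i] that \<open>i < m\<close> es(1) by simp
    then have "exp_weight w2 es = 0"
      unfolding exp_weight_def es(1) by (intro sum.neutral) (auto simp: w2_def)
    then show False using exp_boundD[OF bound2 es(2)] \<open>i < k\<close> by simp
  qed
  then show "Lam m (expansion m r) = 0"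
    unfolding Lam_def by (intro sum.neutral) blast
qed

lemma is_expansion_inverse_monomial:
  assumes k: "Poly_Mapping.keys k \<subseteq> {1..m}"
  shows "is_expansion m (Fract 1 (Poly_Mapping.single k 1))
    (\<lambda>es. if es = map uminus (exponents m k) then 1 else 0)" (is "is_expansion m _ ?f")
proof (rule is_expansion_FractI)
  show "Poly_Mapping.single k (1 :: rat) \<noteq> 0" by (metis lookup_single_eq lookup_zero zero_neq_one)
  have "laurent_poly m ?f"
    by (auto simp: laurent_poly_def length_exponents)
  then show "iterated_laurent m ?f" by (rule iterated_laurent_laurent_poly)
  fix es :: "int list" assume es: "length es = m"
  have zero: "map2 (-) es (exponents m k) = map uminus (exponents m k) \<longleftrightarrow> es = exponents m 0"
    using es by (auto simp: list_eq_iff_nth_eq length_exponents exponents_def simp del: upt_Suc)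
  have "series_of_poly m (Poly_Mapping.single k 1) a = (if a = exponents m k then 1 else 0)" for a
    unfolding series_of_poly_single when_def by auto
  then have "poly_act (series_of_poly m (Poly_Mapping.single k 1)) ?f es = ?f (map2 (-) es (exponents m k))"
    by (simp add: poly_act_def)
  also have "\<dots> = (if es = exponents m 0 then 1 else 0)" by (simp only: zero)
  also have "\<dots> = series_of_poly m 1 es"
    using series_of_poly_single[of m 0 1 es] by (auto simp: when_def)
  finally show "poly_act (series_of_poly m (Poly_Mapping.single k 1)) ?f es = series_of_poly m 1 es" .
qed (use k mpolys_1 mpolys_single in auto)

lemma sum_x_diff_eq_z_var: "(\<Sum>l<j. x_diff (Suc l)) = z_var j"
  by (induction j) (simp_all add: x_diff_def z_var_def)

text \<open>The partial sums telescope to \<open>z_var j\<close>, so \<open>r\<close> is the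
  reciprocal of a monomial in which \<open>z_var j\<close>, for positive \<open>j\<close>, occurs
  once for each prefix with \<open>lis\<close> equal to \<open>j\<close>. As \<open>lis\<close>
  skips no value along the prefixes, the exponent is admissible.\<close>

lemma Lam_identity:
  assumes \<tau>: "lis \<tau> \<le> m"
  defines "r \<equiv> wt (partial_sum_weight (\<lambda>l. x_diff (Suc l)) id) \<tau>"
  shows "r \<in> ratfuns m" "Lam m (expansion m r) = 1"
proof -
  define l where "l = (\<lambda>i. lis (take i \<tau>))"
  \<comment> \<open>The empty prefix has weight \<open>1\<close> and must not contribute a variable
    with index \<open>0\<close>.\<close>
  define u where "u = (\<lambda>j::nat. if j = 0 then 0 else Poly_Mapping.single j (1::nat))"
  define k where "k = (\<Sum>i\<le>length \<tau>. u (l i))"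
  have l_le: "l i \<le> m" for i
    using lis_subseq[OF prefix_imp_subseq[OF take_is_prefix], of i \<tau>] \<tau> by (simp add: l_def)
  have "partial_sum_weight (\<lambda>l. x_diff (Suc l)) id j = Fract 1 (Poly_Mapping.single (u j) 1)" for j
    by (simp add: partial_sum_weight_def sum_x_diff_eq_z_var z_var_def u_def One_fract_def)
  moreover have "(\<Prod>i\<in>I. Fract 1 (Poly_Mapping.single (a i) (1::rat))) =
      Fract 1 (Poly_Mapping.single (sum a I) 1)" for I :: "nat set" and a :: "nat \<Rightarrow> (nat \<Rightarrow>\<^sub>0 nat)"
    by (induction I rule: infinite_finite_induct) (simp_all add: mult_single One_fract_def)
  ultimately have r: "r = Fract 1 (Poly_Mapping.single k 1)"
    by (simp add: r_def wt_def k_def l_def)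
  have lookup_u: "Poly_Mapping.lookup (u j) q = (if j = q \<and> q \<noteq> 0 then 1 else 0)" for j q
    by (auto simp: u_def lookup_single when_def)
  have lookup_k: "Poly_Mapping.lookup k q = 0 \<longleftrightarrow> q = 0 \<or> (\<forall>i\<le>length \<tau>. l i \<noteq> q)" for q
    by (auto simp: k_def lookup_sum lookup_u)
  have "Poly_Mapping.keys k \<subseteq> {1..m}"
  proof
    fix q assume "q \<in> Poly_Mapping.keys k"
    then have "q \<noteq> 0 \<and> (\<exists>i\<le>length \<tau>. l i = q)" by (simp add: in_keys_iff lookup_k)
    then show "q \<in> {1..m}" using l_le by auto
  qed
  from is_expansion_inverse_monomial[OF this]
  have exp: "is_expansion m r (\<lambda>es. if es = map uminus (exponents m k) then 1 else 0)"
    unfolding r .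
  then show "r \<in> ratfuns m" by (rule is_expansion_ratfuns)
  have nth: "map uminus (exponents m k) ! j = - int (Poly_Mapping.lookup k (Suc j))" if "j < m" for j
    using that by (simp add: exponents_def del: upt_Suc)
  have "Poly_Mapping.lookup k (Suc q) = 0" if j: "Poly_Mapping.lookup k (Suc j) = 0" and "j < q" for j q
  proof (rule ccontr)
    assume "Poly_Mapping.lookup k (Suc q) \<noteq> 0"
    then obtain i where i: "i \<le> length \<tau>" "l i = Suc q" by (auto simp: lookup_k)
    then have "Suc j \<le> lis (take i \<tau>)" using \<open>j < q\<close> by (simp add: l_def)
    then obtain i' where "i' \<le> i" "lis (take i' \<tau>) = Suc j"
      using lis_take_intermediate by blast
    then show False using j i(1) by (auto simp: lookup_k l_def)
  qed
  then have "admissible (map uminus (exponents m k))"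
    unfolding admissible_def length_map length_exponents by (simp add: nth del: nth_map)
  then have "{es. length es = m \<and> admissible es \<and> (if es = map uminus (exponents m k) then 1 else 0::rat) \<noteq> 0} =
      {map uminus (exponents m k)}"
    by (auto simp: length_exponents)
  then show "Lam m (expansion m r) = 1"
    unfolding expansion_eq[OF exp] Lam_def by simp
qed

section \<open>Linearity of the operator on rational functions\<close>

lemma Lam_eq_sum:
  assumes "finite A" "{es. length es = m \<and> admissible es \<and> f es \<noteq> 0} \<subseteq> A"
    "\<And>es. es \<in> A \<Longrightarrow> length es = m \<and> admissible es"
  shows "Lam m f = sum f A"
  unfolding Lam_def using assms by (intro sum.mono_neutral_left) auto

text \<open>\<open>Lam\<close> sums over the support, which changes under addition; the union of the
  two admissible supports serves as a common finite index set.\<close>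

lemma Lam_expansion_add:
  assumes "r \<in> ratfuns m" "s \<in> ratfuns m"
  shows "Lam m (expansion m (r + s)) = Lam m (expansion m r) + Lam m (expansion m s)"
proof -
  let ?f = "expansion m r" and ?g = "expansion m s"
  note f = is_expansion_expansion[OF assms(1)] and g = is_expansion_expansion[OF assms(2)]
  let ?A = "{es. length es = m \<and> admissible es \<and> ?f es \<noteq> 0} \<union> {es. length es = m \<and> admissible es \<and> ?g es \<noteq> 0}"
  have fin: "finite ?A"
    using f g by (intro finite_UnI finite_admissible is_expansion_iterated_laurent)
  have "Lam m (expansion m (r + s)) = Lam m (\<lambda>es. ?f es + ?g es)"
    by (simp only: expansion_eq[OF is_expansion_add[OF f g]])
  also have "\<dots> = (\<Sum>es\<in>?A. ?f es + ?g es)" by (rule Lam_eq_sum[OF fin]) auto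
  also have "\<dots> = sum ?f ?A + sum ?g ?A" by (rule sum.distrib)
  also have "sum ?f ?A = Lam m ?f" by (rule Lam_eq_sum[OF fin, symmetric]) auto
  also have "sum ?g ?A = Lam m ?g" by (rule Lam_eq_sum[OF fin, symmetric]) auto
  finally show ?thesis .
qed

lemma Lam_expansion_0: "Lam m (expansion m 0) = 0"
  by (simp add: expansion_eq[OF is_expansion_0] Lam_def)

lemma Lam_expansion_sum:
  "(\<And>i. i \<in> I \<Longrightarrow> r i \<in> ratfuns m) \<Longrightarrow>
    Lam m (expansion m (sum r I)) = (\<Sum>i\<in>I. Lam m (expansion m (r i)))"
  by (induction I rule: infinite_finite_induct)
     (simp_all add: Lam_expansion_0 Lam_expansion_add ratfuns_sum)

lemma ratfuns_minus: "r \<in> ratfuns m \<Longrightarrow> - r \<in> ratfuns m"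
  using ratfuns_diff[OF ratfuns_0, of r m] by simp

lemma ratfuns_sign: "r \<in> ratfuns m \<Longrightarrow> of_int (sign p) * r \<in> ratfuns m"
  by (simp add: sign_def ratfuns_minus)

lemma Lam_expansion_sign:
  assumes "r \<in> ratfuns m"
  shows "Lam m (expansion m (of_int (sign p) * r)) = of_int (sign p) * Lam m (expansion m r)"
  using Lam_expansion_add[OF assms ratfuns_minus[OF assms]] by (simp add: sign_def Lam_expansion_0)

lemma ratfuns_of_nat: "of_nat k \<in> ratfuns m"
  by (induction k) (auto intro: ratfuns_0 ratfuns_1 ratfuns_add)

lemma Lam_expansion_of_nat_mult:
  assumes "r \<in> ratfuns m"
  shows "Lam m (expansion m (of_nat k * r)) = of_nat k * Lam m (expansion m r)"
  by (induction k)
     (simp_all add: Lam_expansion_0 distrib_right Lam_expansion_add assms ratfuns_mult ratfuns_of_nat)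

text \<open>Reduced to multiplication by \<open>k\<close>, that is, to repeated addition. It handles
  the factorials in the exponential generating function.\<close>

lemma Lam_expansion_divide_of_nat:
  assumes "r \<in> ratfuns m" "k \<noteq> 0"
  shows "Lam m (expansion m (r / of_nat k)) = Lam m (expansion m r) / of_nat k"
  using Lam_expansion_of_nat_mult[OF ratfuns_divide[OF assms(1) ratfuns_of_nat], of k k] assms(2)
  by (simp add: field_simps)

lemma Lam_det_power_times_power_sum:
  fixes m n :: nat
  assumes m: "m \<ge> 1"
  defines "r \<equiv> det (mat m m (\<lambda>(i, j). x_diff (Suc j) powi (int i - int j))) * (\<Sum>l<m. 1 / x_diff (Suc l)) ^ n"
  shows "r \<in> ratfuns m" "Lam m (expansion m r) = of_nat (card (perms_no_asc_of m n))"
proof -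
  define T where "T = (\<lambda>p (\<tau> :: nat list). (\<Prod>l<m. x_diff (Suc (p l)) powi (int l - int (p l))) *
      wt (partial_sum_weight (\<lambda>l. x_diff (Suc l)) p) \<tau>)"
  have r: "r = (\<Sum>p | p permutes {..<m}. \<Sum>\<tau>\<in>perms_no_asc_of m n. of_int (sign p) * T p \<tau>)"
    unfolding r_def T_def using m by (rule det_power_times_power_sum) (rule sum_x_diff_neq_0)
  have T: "T p \<tau> \<in> ratfuns m \<and> Lam m (expansion m (T p \<tau>)) = (if p = id then 1 else 0)"
    if "p permutes {..<m}" "\<tau> \<in> perms_no_asc_of m n" for p \<tau>
  proof (cases "p = id")
    case True
    then have "T p \<tau> = wt (partial_sum_weight (\<lambda>l. x_diff (Suc l)) id) \<tau>" by (simp add: T_def)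
    then show ?thesis using Lam_identity[of \<tau> m] that(2) True by (simp add: perms_no_asc_of_iff)
  next
    case False
    then show ?thesis
      using Lam_nonidentity[OF that(1) False, of \<tau>] that(2) by (simp add: perms_no_asc_of_iff T_def)
  qed
  show "r \<in> ratfuns m"
    unfolding r using T by (intro ratfuns_sum ratfuns_sign) auto
  have "Lam m (expansion m r) = (\<Sum>p | p permutes {..<m}.
      Lam m (expansion m (\<Sum>\<tau>\<in>perms_no_asc_of m n. of_int (sign p) * T p \<tau>)))"
    unfolding r by (intro Lam_expansion_sum ratfuns_sum ratfuns_sign) (use T in auto)
  also have "\<dots> = (\<Sum>p | p permutes {..<m}. \<Sum>\<tau>\<in>perms_no_asc_of m n.
      Lam m (expansion m (of_int (sign p) * T p \<tau>)))"
    by (intro sum.cong refl Lam_expansion_sum ratfuns_sign) (use T in auto)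
  also have "\<dots> = (\<Sum>p | p permutes {..<m}. \<Sum>\<tau>\<in>perms_no_asc_of m n.
      of_int (sign p) * (if p = id then 1 else 0))"
    using T by (intro sum.cong refl) (simp add: Lam_expansion_sign)
  also have "\<dots> = (\<Sum>p | p permutes {..<m}. if p = id then of_nat (card (perms_no_asc_of m n)) else 0)"
    by (intro sum.cong) auto
  also have "\<dots> = of_nat (card (perms_no_asc_of m n))"
    by (simp add: finite_permutations permutes_id)
  finally show "Lam m (expansion m r) = of_nat (card (perms_no_asc_of m n))" .
qed

section \<open>The two generating functions\<close>

lemma fps_const_divide_geometric:
  fixes a c :: "'a::field"
  shows "fps_const a / (1 - fps_X * fps_const c) = Abs_fps (\<lambda>n. a * c ^ n)"
proof -
  let ?d = "1 - fps_X * fps_const c"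
  have "Abs_fps (\<lambda>n. a * c ^ n) * ?d = fps_const a"
  proof (rule fps_ext)
    fix n
    have "Abs_fps (\<lambda>n. a * c ^ n) * ?d =
        Abs_fps (\<lambda>n. a * c ^ n) - fps_X * (fps_const c * Abs_fps (\<lambda>n. a * c ^ n))"
      by (simp add: algebra_simps)
    then show "fps_nth (Abs_fps (\<lambda>n. a * c ^ n) * ?d) n = fps_nth (fps_const a) n"
      by (cases n) simp_all
  qed
  moreover have "?d \<noteq> 0"
  proof
    assume "?d = 0"
    then have "fps_nth ?d 0 = 0" by simp
    then show False by simp
  qed
  ultimately show ?thesis by (metis nonzero_mult_div_cancel_right)
qed

text \<open>Each Leibniz term uses every column once, so its exponentials multiply to the
  exponential of the sum of all \<open>c l\<close>, whatever the permutation.\<close>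

lemma det_fps_const_mult_fps_exp:
  fixes a :: "nat \<Rightarrow> nat \<Rightarrow> 'a::field_char_0"
  shows "det (mat m m (\<lambda>(i, j). fps_const (a i j) * fps_exp (c j))) =
    fps_const (det (mat m m (\<lambda>(i, j). a i j))) * fps_exp (\<Sum>l<m. c l)"
proof -
  have const_prod: "(\<Prod>i\<in>I. fps_const (b i)) = fps_const (prod b I)" for b :: "nat \<Rightarrow> 'a" and I
    by (induction I rule: infinite_finite_induct) simp_all
  have const_sum: "(\<Sum>p\<in>I. fps_const (b p)) = fps_const (sum b I)"
    for b :: "(nat \<Rightarrow> nat) \<Rightarrow> 'a" and I
    by (induction I rule: infinite_finite_induct) simp_all
  have exp_prod: "(\<Prod>i\<in>I. fps_exp (b i)) = fps_exp (sum b I)" for b :: "nat \<Rightarrow> 'a" and I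
    by (induction I rule: infinite_finite_induct) (simp_all add: fps_exp_add_mult)
  have "det (mat m m (\<lambda>(i, j). fps_const (a i j) * fps_exp (c j))) =
      (\<Sum>p | p permutes {..<m}. fps_const (signof p * (\<Prod>i<m. a i (p i))) * fps_exp (\<Sum>l<m. c l))"
    unfolding det_def'[OF mat_carrier] atLeast0LessThan
  proof (rule sum.cong)
    fix p assume "p \<in> {p. p permutes {..<m}}"
    then have p: "p permutes {..<m}" by simp
    then have "p i < m" if "i < m" for i using that permutes_in_image[OF p, of i] by simp
    then have "(\<Prod>i<m. mat m m (\<lambda>(i, j). fps_const (a i j) * fps_exp (c j)) $$ (i, p i)) =
        (\<Prod>i<m. fps_const (a i (p i)) * fps_exp (c (p i)))"
      by (intro prod.cong) auto
    also have "\<dots> = fps_const (\<Prod>i<m. a i (p i)) * fps_exp (\<Sum>i<m. c (p i))"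
      by (simp add: prod.distrib const_prod exp_prod)
    also have "(\<Sum>i<m. c (p i)) = (\<Sum>l<m. c l)"
      using sum.permute[OF p, of c] by (simp add: o_def)
    finally show "signof p * (\<Prod>i<m. mat m m (\<lambda>(i, j). fps_const (a i j) * fps_exp (c j)) $$ (i, p i)) =
        fps_const (signof p * (\<Prod>i<m. a i (p i))) * fps_exp (\<Sum>l<m. c l)"
      by (simp add: sign_def)
  qed simp
  also have "\<dots> = fps_const (\<Sum>p | p permutes {..<m}. signof p * (\<Prod>i<m. a i (p i))) * fps_exp (\<Sum>l<m. c l)"
    by (simp add: const_sum flip: sum_distrib_right)
  also have "(\<Sum>p | p permutes {..<m}. signof p * (\<Prod>i<m. a i (p i))) = det (mat m m (\<lambda>(i, j). a i j))"
    unfolding det_def'[OF mat_carrier] atLeast0LessThan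
  proof (rule sum.cong)
    fix p assume "p \<in> {p. p permutes {..<m}}"
    then have p: "p permutes {..<m}" by simp
    then have "p i < m" if "i < m" for i using that permutes_in_image[OF p, of i] by simp
    then show "signof p * (\<Prod>i<m. a i (p i)) = signof p * (\<Prod>i<m. mat m m (\<lambda>(i, j). a i j) $$ (i, p i))"
      by simp
  qed simp
  finally show ?thesis .
qed

theorem proposition13:
  fixes m :: nat
  assumes "m \<ge> 1"
  shows "(Abs_fps (\<lambda>n. \<Sum>\<tau> | \<tau> \<in> perms_no_asc m \<and> length \<tau> = n. 1) :: rat fps) =
           Lam_fps m
             (fps_const (det (mat m m (\<lambda>(i, j). x_diff (Suc j) powi (int (Suc i) - int (Suc j))))) /
              (1 - fps_X * fps_const (\<Sum>j = 1..m. 1 / x_diff j)))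
       \<and> (Abs_fps (\<lambda>n. \<Sum>\<tau> | \<tau> \<in> perms_no_asc m \<and> length \<tau> = n. 1 / fact (length \<tau>)) :: rat fps) =
           Lam_fps m
             (det (mat m m (\<lambda>(i, j).
                fps_const (x_diff (Suc j) powi (int (Suc i) - int (Suc j))) * fps_exp (1 / x_diff (Suc j)))))"
proof -
  let ?D = "det (mat m m (\<lambda>(i, j). x_diff (Suc j) powi (int i - int j)))"
  let ?s = "\<Sum>l<m. 1 / x_diff (Suc l)"
  \<comment> \<open>Matrix positions start at \<open>0\<close>, so the statement shifts both indices
    by one; the shifts cancel in the exponents.\<close>
  have ints: "int (Suc i) - int (Suc j) = int i - int j" for i j by simp
  have s: "(\<Sum>j = 1..m. 1 / x_diff j) = ?s" by (simp add: sum.atLeast1_atMost_eq)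
  note Lam = Lam_det_power_times_power_sum[OF assms]
  have ogf: "(\<Sum>\<tau> | \<tau> \<in> perms_no_asc m \<and> length \<tau> = n. 1 :: rat) = Lam m (expansion m (?D * ?s ^ n))" for n
    by (simp add: Lam(2) flip: perms_no_asc_of_def)
  have egf: "(\<Sum>\<tau> | \<tau> \<in> perms_no_asc m \<and> length \<tau> = n. 1 / fact (length \<tau>) :: rat) =
      Lam m (expansion m (?D * (?s ^ n / fact n)))" for n
  proof -
    have "(\<Sum>\<tau> | \<tau> \<in> perms_no_asc m \<and> length \<tau> = n. 1 / fact (length \<tau>) :: rat) =
        of_nat (card (perms_no_asc_of m n)) / of_nat (fact n)"
      by (simp flip: perms_no_asc_of_def cong: sum.cong add: length_perms_no_asc_of)
    also have "\<dots> = Lam m (expansion m (?D * ?s ^ n / of_nat (fact n)))"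
      by (subst Lam_expansion_divide_of_nat[OF Lam(1)]) (simp_all add: Lam(2))
    finally show ?thesis by simp
  qed
  have exp_nth: "fps_nth (fps_const a * fps_exp c) n = a * (c ^ n / fact n)" for a c :: ratfun and n
    by simp
  show ?thesis
    unfolding ints s fps_const_divide_geometric det_fps_const_mult_fps_exp Lam_fps_def
      fps_nth_Abs_fps exp_nth ogf egf by (rule conjI refl)+
qed

end
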